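(* For all integers $0\le k\le r$ there is a constant $\tau$ depending only on $k$ such that whenever $b=\binom{c_{k-1}}{k-1}+\dots+\binom{c_1}{1}$ for some integers $c_{k-1}>c_{k-2}>\dots>c_1\ge 0$, we have \[\binom{c_{k-1}}{k}+\dots+\binom{c_1}{2}\;\le\; f(r,k,b)\;\le\;\binom{c_{k-1}}{k}+\dots+\binom{c_1}{2}+\tau.\]
   Context: $\mathbb{N}^{(s)}$ denotes the family of all $s$-element subsets of $\mathbb{N}$. For integers $0\le k\le r$ and $b\ge 0$, $f(r,k,b)$ denotes the maximum of $|\mathcal{A}|$ over all pairs of families $\mathcal{A}\subset\mathbb{N}^{(r)}$, $\mathcal{B}\subset\mathbb{N}^{(r-1)}$ with $|\mathcal{B}|=b$ such that for every $A\in\mathcal{A}$ there exist $k$ distinct sets $B_1,\dots,B_k\in\mathcal{B}$ with $B_i\subset A$ for all $i$. Binomial coefficients $\binom{c}{i}$ with $c<i$ are $0$.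
   Formalization: The formal theorem assumes k ≥ 1: for k = 0 (so b = 0) and r ≥ 1 the condition on the family A is vacuous, so f(r,0,0) is unbounded and the upper bound fails. *)

theory Defs
  imports Main "HOL-Library.Extended_Nat"
begin

definition nsets_nat :: "nat \<Rightarrow> nat set set" where
  "nsets_nat s = {X. finite X \<and> card X = s}"

text \<open>f(r,k,b): the maximum of the size of a family A of r-sets such that, for some family B of
 (r-1)-sets with |B| = b, each member of A contains k distinct members of B. Taken as a supremum
 in the extended naturals (it is infinity when the maximum does not exist).\<close>
definition f_max :: "nat \<Rightarrow> nat \<Rightarrow> nat \<Rightarrow> enat" where
  "f_max r k b = Sup {enat (card \<A>) | \<A> \<B>.
      finite \<A> \<and> \<A> \<subseteq> nsets_nat r \<and> \<B> \<subseteq> nsets_nat (r - 1) \<and> finite \<B> \<and> card \<B> = b \<and>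
      (\<forall>A\<in>\<A>. \<exists>S. S \<subseteq> \<B> \<and> card S = k \<and> (\<forall>X\<in>S. X \<subseteq> A))}"

end

theory Submission
  imports Defs "HOL-Combinatorics.Transposition" "HOL-Library.Ramsey"
begin

text \<open>
  Write \<open>k = j + 1\<close>, let \<open>g\<close> be the Kruskal--Katona function of the cascade and let \<open>b\<close> be the
  number of \<open>(r - 1)\<close>-sets. For any set \<open>X\<close>, let \<open>b\<^sub>0\<close> of them contain \<open>X\<close> and \<open>b\<^sub>1\<close> not. An
  \<open>r\<close>-set \<open>A \<supseteq> X\<close> containing some \<open>B\<close> of the second kind is \<open>B \<union> X\<close>, so
  \<open>f(b) \<le> f(b\<^sub>0) + f(b\<^sub>1) + b\<^sub>1\<close>. As \<open>g\<close> is superlinear, \<open>g(b) \<ge> g(b\<^sub>0) + g(b\<^sub>1) + b\<^sub>1\<close> unless \<open>b\<^sub>1\<close> is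
  bounded or \<open>b\<^sub>0 = O(b^((j - 1)/j))\<close>, and induction on \<open>b\<close> applies. Otherwise every vertex is
  either common (missed by boundedly many sets) or rare (in \<open>O(b^((j - 1)/j))\<close> of them), and
  the set \<open>X\<close> of common vertices is contained in all but boundedly many sets. If \<open>|X| \<ge> r - k\<close>,
  the links of an \<open>(r - k)\<close>-subset of \<open>X\<close> form a genuine Kruskal--Katona problem. If \<open>|X| < r - k\<close>
  and \<open>|\<A>| > g(b)\<close>, prune to minimum degree of order \<open>b^(1/j)\<close>; exchanging \<open>j\<close> elements one at a
  time reaches from a fixed \<open>B\<^sub>0\<close> a positive proportion of all sets, each sharing \<open>r - k - |X| > 0\<close>
  rare vertices with \<open>B\<^sub>0\<close>, which is too many.

  The induction is run twice: errors add up in a split, so the first run only yields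
  \<open>f(b) \<le> g(b) + O(b)\<close>; in the second run the gain in \<open>g\<close> absorbs the linear error of the smaller part.
\<close>

section \<open>Shadows and compressions\<close>

definition shadow :: "'a set set \<Rightarrow> 'a set set" where
  "shadow \<F> = (\<Union>S\<in>\<F>. (\<lambda>x. S - {x}) ` S)"

definition link :: "'a \<Rightarrow> 'a set set \<Rightarrow> 'a set set" where
  "link v \<F> = {S. v \<notin> S \<and> insert v S \<in> \<F>}"

definition deletion :: "'a \<Rightarrow> 'a set set \<Rightarrow> 'a set set" where
  "deletion v \<F> = {S\<in>\<F>. v \<notin> S}"

text \<open>The image \<open>transpose v x ` S\<close> differs from \<open>S\<close> only if \<open>S\<close> contains exactly one of \<open>v\<close> and \<open>x\<close>, so
  this is the usual compression replacing \<open>x\<close> by \<open>v\<close>.\<close>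

definition shift :: "'a \<Rightarrow> 'a \<Rightarrow> 'a set set \<Rightarrow> 'a set set" where
  "shift v x \<F> = {S. if v \<in> S then S \<in> \<F> \<or> transpose v x ` S \<in> \<F>
                      else S \<in> \<F> \<and> transpose v x ` S \<in> \<F>}"

lemma shadow_memI: "S \<in> \<F> \<Longrightarrow> x \<in> S \<Longrightarrow> S - {x} \<in> shadow \<F>"
  by (auto simp: shadow_def)

lemma shadow_memE:
  assumes "T \<in> shadow \<F>"
  obtains S x where "S \<in> \<F>" "x \<in> S" "T = S - {x}"
  using assms by (auto simp: shadow_def)

lemma shadow_subset_nsets: "\<F> \<subseteq> [V]\<^bsup>Suc r\<^esup> \<Longrightarrow> shadow \<F> \<subseteq> [V]\<^bsup>r\<^esup>"
  by (fastforce simp: shadow_def nsets_def)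

lemma finite_shadow: "finite \<F> \<Longrightarrow> \<F> \<subseteq> [V]\<^bsup>r\<^esup> \<Longrightarrow> finite (shadow \<F>)"
  by (auto simp: shadow_def nsets_def)

lemma eq_empty_if_shadow_empty:
  assumes "\<F> \<subseteq> [V]\<^bsup>Suc r\<^esup>" "shadow \<F> = {}"
  shows "\<F> = {}"
  using assms by (force simp: shadow_def nsets_def card_Suc_eq)

lemma
  assumes "finite \<F>"
  shows finite_link: "finite (link v \<F>)"
    and card_link_deletion: "card \<F> = card (link v \<F>) + card (deletion v \<F>)"
proof -
  have bij: "bij_betw (insert v) (link v \<F>) {S\<in>\<F>. v \<in> S}"
    by (rule bij_betw_byWitness[where f' = "\<lambda>S. S - {v}"]) (auto simp: link_def insert_absorb)
  then show "finite (link v \<F>)" using assms bij_betw_finite by force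
  have "\<F> = {S\<in>\<F>. v \<in> S} \<union> deletion v \<F>" by (auto simp: deletion_def)
  also have "card \<dots> = card {S\<in>\<F>. v \<in> S} + card (deletion v \<F>)"
    using assms by (intro card_Un_disjoint) (auto simp: deletion_def)
  finally show "card \<F> = card (link v \<F>) + card (deletion v \<F>)"
    using bij_betw_same_card[OF bij] by simp
qed

lemma deletion_subset_nsets: "\<F> \<subseteq> [V]\<^bsup>r\<^esup> \<Longrightarrow> deletion v \<F> \<subseteq> [V]\<^bsup>r\<^esup>"
  by (auto simp: deletion_def)

lemma link_subset_nsets: "\<F> \<subseteq> [V]\<^bsup>Suc r\<^esup> \<Longrightarrow> link v \<F> \<subseteq> [V]\<^bsup>r\<^esup>"
  by (force simp: link_def nsets_def)

lemma link_subset_deletion_shadow: "link v \<F> \<subseteq> deletion v (shadow \<F>)"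
proof
  fix S assume "S \<in> link v \<F>"
  then show "S \<in> deletion v (shadow \<F>)"
    using shadow_memI[of "insert v S" \<F> v] by (simp add: link_def deletion_def)
qed

lemma shadow_link_subset: "shadow (link v \<F>) \<subseteq> link v (shadow \<F>)"
proof
  fix T assume "T \<in> shadow (link v \<F>)"
  then obtain S x where S: "v \<notin> S" "insert v S \<in> \<F>" "x \<in> S" "T = S - {x}"
    by (auto simp: link_def elim: shadow_memE)
  then have "insert v T = insert v S - {x}" by auto
  then show "T \<in> link v (shadow \<F>)" using S shadow_memI[of "insert v S" \<F> x] by (simp add: link_def)
qed

lemma card_link_add_shadow_link_le:
  assumes "finite (shadow \<F>)"
  shows "card (link v \<F>) + card (shadow (link v \<F>)) \<le> card (shadow \<F>)"
proof -
  have "card (link v \<F>) \<le> card (deletion v (shadow \<F>))"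
    using assms by (intro card_mono link_subset_deletion_shadow) (simp add: deletion_def)
  moreover have "card (shadow (link v \<F>)) \<le> card (link v (shadow \<F>))"
    by (intro card_mono finite_link assms shadow_link_subset)
  ultimately show ?thesis using card_link_deletion[OF assms, of v] by linarith
qed

lemma transpose_image_mem_iff: "transpose v x ` S \<noteq> S \<Longrightarrow> v \<in> transpose v x ` S \<longleftrightarrow> v \<notin> S"
  using transpose_image_eq[of v S x] unfolding in_transpose_image_iff transpose_apply_first by blast

lemma transpose_image_involutory: "transpose v x ` transpose v x ` S = S"
  by (simp add: image_comp)

lemma transpose_image_remove: "transpose v x ` (S - {u}) = transpose v x ` S - {transpose v x u}"
  by (simp add: image_set_diff[OF inj_transpose])

lemma bij_betw_shift:
  "bij_betw (\<lambda>S. if v \<notin> S \<and> transpose v x ` S \<notin> \<F> then transpose v x ` S else S) \<F> (shift v x \<F>)"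
proof -
  define swap where "swap S = transpose v x ` S" for S
  have swap_swap: "swap (swap S) = S" for S
    unfolding swap_def by (rule transpose_image_involutory)
  have v_mem_swap: "v \<in> swap S \<longleftrightarrow> v \<notin> S" if "S \<in> \<F>" "swap S \<notin> \<F>" for S
    using that transpose_image_mem_iff[of v x S] unfolding swap_def by metis
  show ?thesis
    unfolding shift_def swap_def[symmetric]
    by (rule bij_betw_byWitness[where f' = "\<lambda>S. if v \<in> S \<and> S \<notin> \<F> then swap S else S"])
      (auto simp: swap_swap v_mem_swap split: if_splits, (metis swap_swap v_mem_swap)+)
qed

lemma card_shift: "card (shift v x \<F>) = card \<F>"
  using bij_betw_same_card[OF bij_betw_shift] by metis

lemma finite_shift: "finite (shift v x \<F>) \<longleftrightarrow> finite \<F>"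
  using bij_betw_finite[OF bij_betw_shift] by metis

lemma shift_subset_nsets:
  assumes "\<F> \<subseteq> [UNIV]\<^bsup>r\<^esup>" shows "shift v x \<F> \<subseteq> [UNIV]\<^bsup>r\<^esup>"
proof
  fix S assume "S \<in> shift v x \<F>"
  then consider "S \<in> \<F>" | "transpose v x ` S \<in> \<F>" by (auto simp: shift_def split: if_splits)
  then show "S \<in> [UNIV]\<^bsup>r\<^esup>"
    using assms by cases (auto simp: nsets_def card_image finite_image_iff simp del: transpose_image_eq)
qed

lemma shadow_shift_subset: "shadow (shift v x \<F>) \<subseteq> shift v x (shadow \<F>)"
proof
  fix T assume "T \<in> shadow (shift v x \<F>)"
  then obtain S u where S: "S \<in> shift v x \<F>" and u: "u \<in> S" and T: "T = S - {u}" by (rule shadow_memE)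
  let ?swap = "\<lambda>R. transpose v x ` R"
  have swap_T: "?swap T = ?swap S - {transpose v x u}" unfolding T by (rule transpose_image_remove)
  have T_shadow: "T \<in> shadow \<F>" if "S \<in> \<F>" using that u by (simp add: T shadow_memI)
  have swap_T_shadow: "?swap T \<in> shadow \<F>" if "?swap S \<in> \<F>"
    unfolding swap_T using that u by (intro shadow_memI imageI)
  consider (avoids) "v \<notin> S" | (contains) "v \<in> T"
    | (both) "u = v" "x \<in> S" | (only) "u = v" "x \<notin> S" using T by blast
  then show "T \<in> shift v x (shadow \<F>)"
  proof cases
    case avoids
    then show ?thesis using S T_shadow swap_T_shadow by (auto simp: shift_def T)
  next
    case contains
    then show ?thesis using S T_shadow swap_T_shadow by (auto simp: shift_def T split: if_splits)
  next
    case both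
    then have "?swap S = S" "S \<in> \<F>" "?swap T = S - {x}" using u S swap_T by (auto simp: shift_def)
    then show ?thesis using both T_shadow by (simp add: shift_def T shadow_memI)
  next
    case only
    then have "?swap T = T" using T by simp
    then show ?thesis
      using only u S T_shadow swap_T_shadow by (auto simp: shift_def T split: if_splits)
  qed
qed

lemma obtain_compressed:
  fixes \<F> :: "'a set set" and v :: 'a
  assumes "finite \<F>" "\<F> \<subseteq> [UNIV]\<^bsup>Suc r\<^esup>"
  obtains \<G> where "finite \<G>" "\<G> \<subseteq> [UNIV]\<^bsup>Suc r\<^esup>" "card \<G> = card \<F>"
    "card (shadow \<G>) \<le> card (shadow \<F>)" "shadow (deletion v \<G>) \<subseteq> link v \<G>"
  using assms
proof (induction "card (deletion v \<F>)" arbitrary: \<F> thesis rule: less_induct)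
  case less
  show ?case
  proof (cases "\<forall>S\<in>deletion v \<F>. \<forall>x\<in>S. transpose v x ` S \<in> \<F>")
    case True
    have "shadow (deletion v \<F>) \<subseteq> link v \<F>"
    proof
      fix T assume "T \<in> shadow (deletion v \<F>)"
      then obtain S x where S: "S \<in> deletion v \<F>" "x \<in> S" and T: "T = S - {x}" by (rule shadow_memE)
      have "transpose v x ` S = insert v T"
        using S unfolding T deletion_def by (auto simp: transpose_def image_iff)
      then have "insert v T \<in> \<F>" using True S by metis
      then show "T \<in> link v \<F>" using S by (simp add: link_def deletion_def T)
    qed
    then show ?thesis using less.prems by blast
  next
    case False
    then obtain S x where "S \<in> deletion v \<F>" "x \<in> S" "transpose v x ` S \<notin> \<F>" by blast
    then have "deletion v (shift v x \<F>) \<subset> deletion v \<F>" by (auto simp: deletion_def shift_def)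
    then have fewer: "card (deletion v (shift v x \<F>)) < card (deletion v \<F>)"
      using less.prems(2) by (intro psubset_card_mono) (auto simp: deletion_def)
    obtain \<G> where \<G>: "finite \<G>" "\<G> \<subseteq> [UNIV]\<^bsup>Suc r\<^esup>" "card \<G> = card (shift v x \<F>)"
      "card (shadow \<G>) \<le> card (shadow (shift v x \<F>))" "shadow (deletion v \<G>) \<subseteq> link v \<G>"
      using less.hyps[OF fewer] less.prems(2,3) by (metis finite_shift shift_subset_nsets)
    have "card (shadow (shift v x \<F>)) \<le> card (shift v x (shadow \<F>))"
      using finite_shadow[OF less.prems(2,3)]
      by (intro card_mono shadow_shift_subset) (simp add: finite_shift)
    then have "card (shadow (shift v x \<F>)) \<le> card (shadow \<F>)" by (simp add: card_shift)
    then show ?thesis using \<G> less.prems(1)[of \<G>] by (simp add: card_shift)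
  qed
qed

section \<open>The Kruskal--Katona theorem\<close>

text \<open>A cascade \<open>c\<^sub>j > \<dots> > c\<^sub>1 \<ge> 0\<close> is encoded by the nondecreasing \<open>e i = c\<^sub>i\<^sub>+\<^sub>1 - i\<close>; this makes Pascal's
  rule hold termwise without side conditions on vanishing binomial coefficients.\<close>

definition cascade :: "nat \<Rightarrow> nat \<Rightarrow> (nat \<Rightarrow> nat) \<Rightarrow> nat" where
  "cascade s j e = (\<Sum>i<j. (i + e i) choose (Suc i + s))"

lemma cascade_Suc_pred:
  "cascade (Suc s) j e = cascade (Suc s) j (\<lambda>i. e i - 1) + cascade s j (\<lambda>i. e i - 1)"
proof -
  have "(i + n) choose (Suc i + Suc s) =
      ((i + (n - 1)) choose (Suc i + Suc s)) + ((i + (n - 1)) choose (Suc i + s))" for i n :: nat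
    by (cases n) auto
  then show ?thesis unfolding cascade_def sum.distrib[symmetric] by (intro sum.cong refl)
qed

lemma cascade_0_le_pred:
  "cascade 0 (Suc j) e \<le> cascade 0 (Suc j) (\<lambda>i. e i - 1) + cascade 0 j (\<lambda>i. e (Suc i)) + 1"
proof -
  have "(Suc i + n) choose (Suc (Suc i)) \<le>
      ((Suc i + (n - 1)) choose (Suc (Suc i))) + ((i + n) choose (Suc i))" for i n :: nat
    by (cases n) auto
  then have "(\<Sum>i<j. (Suc i + e (Suc i)) choose (Suc (Suc i))) \<le>
      (\<Sum>i<j. ((Suc i + (e (Suc i) - 1)) choose (Suc (Suc i))) + ((i + e (Suc i)) choose (Suc i)))"
    by (intro sum_mono)
  then show ?thesis unfolding cascade_def sum.lessThan_Suc_shift by (simp add: sum.distrib)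
qed

lemma cascade_Suc_shift_le: "cascade (Suc s) j (\<lambda>i. e (Suc i)) \<le> cascade s (Suc j) (\<lambda>i. e i - 1)"
proof -
  have "(i + n) choose (Suc i + Suc s) \<le> (Suc i + (n - 1)) choose (Suc (Suc i) + s)" for i n :: nat
    by (cases n) auto
  then have "cascade (Suc s) j (\<lambda>i. e (Suc i)) \<le>
      (\<Sum>i<j. (Suc i + (e (Suc i) - 1)) choose (Suc (Suc i) + s))"
    unfolding cascade_def by (intro sum_mono)
  then show ?thesis unfolding cascade_def sum.lessThan_Suc_shift by simp
qed

lemma cascade_0_eq_0: "mono e \<Longrightarrow> e j = 0 \<Longrightarrow> cascade 0 (Suc j) e = 0"
  using monoD[of e _ j] by (simp add: cascade_def less_Suc_eq_le)

lemma card_link_le_cascade: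
  assumes "finite \<F>" "\<F> \<subseteq> [UNIV]\<^bsup>Suc r\<^esup>" "card (shadow \<F>) \<le> cascade 0 (Suc j) e"
    and link: "card (shadow (link v \<F>)) \<le> cascade 0 j (\<lambda>i. e (Suc i)) \<Longrightarrow>
      card (link v \<F>) \<le> cascade 1 j (\<lambda>i. e (Suc i))"
  shows "card (link v \<F>) \<le> cascade 0 (Suc j) (\<lambda>i. e i - 1)"
proof (cases "card (shadow (link v \<F>)) \<le> cascade 0 j (\<lambda>i. e (Suc i))")
  case True
  then show ?thesis using link cascade_Suc_shift_le[of 0 j e] by simp
next
  case False
  then show ?thesis
    using card_link_add_shadow_link_le[OF finite_shadow[OF assms(1,2)], of v] assms(3)
      cascade_0_le_pred[of j e] by linarith
qed

text \<open>Frankl's proof. In a family compressed towards \<open>v\<close>, the sets avoiding \<open>v\<close> have their shadow in the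
  link of \<open>v\<close>, so it suffices to bound the size of that link.\<close>

theorem kruskal_katona:
  fixes \<F> :: "'a set set"
  assumes "mono e" "finite \<F>" "\<F> \<subseteq> [UNIV]\<^bsup>Suc j\<^esup>" "card (shadow \<F>) \<le> cascade 0 j e"
  shows "card \<F> \<le> cascade 1 j e"
  using assms
proof (induction j arbitrary: e \<F>)
  case 0
  then have "\<F> = {}"
    using eq_empty_if_shadow_empty[OF "0.prems"(3)] finite_shadow[OF "0.prems"(2,3)]
    by (simp add: cascade_def)
  then show ?case by simp
next
  case (Suc j)
  note smaller_uniformity = Suc.IH
  from Suc.prems show ?case
  proof (induction "e j" arbitrary: e \<F>)
    case 0
    then have "\<F> = {}"
      using eq_empty_if_shadow_empty[OF "0.prems"(3)] finite_shadow[OF "0.prems"(2,3)]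
      by (simp add: cascade_0_eq_0)
    then show ?case by simp
  next
    case (Suc t)
    fix v :: 'a
    obtain \<G> where \<G>: "finite \<G>" "\<G> \<subseteq> [UNIV]\<^bsup>Suc (Suc j)\<^esup>" "card \<G> = card \<F>"
      and shadow_\<G>: "card (shadow \<G>) \<le> card (shadow \<F>)"
      and compressed: "shadow (deletion v \<G>) \<subseteq> link v \<G>"
      by (rule obtain_compressed[OF Suc.prems(2,3), of v])
    have mono_pred: "mono (\<lambda>i. e i - 1)" and mono_shift: "mono (\<lambda>i. e (Suc i))"
      using Suc.prems(1) by (auto simp: mono_def diff_le_mono)
    have link_le: "card (link v \<G>) \<le> cascade 0 (Suc j) (\<lambda>i. e i - 1)"
      using \<G>(1,2) shadow_\<G> Suc.prems(4)
      by (intro card_link_le_cascade smaller_uniformity mono_shift finite_link link_subset_nsets) auto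
    have "card (deletion v \<G>) \<le> cascade 1 (Suc j) (\<lambda>i. e i - 1)"
      using Suc.hyps(2) \<G>(1,2) link_le card_mono[OF finite_link[OF \<G>(1)] compressed]
      by (intro Suc.hyps(1) mono_pred deletion_subset_nsets) (auto simp: deletion_def)
    then show ?case
      using link_le card_link_deletion[OF \<G>(1), of v] \<G>(3) cascade_Suc_pred[of 0 "Suc j" e] by simp
  qed
qed

section \<open>The Kruskal--Katona function\<close>

text \<open>An initial segment of the colexicographic order on \<open>(j + s)\<close>-sets.\<close>

primrec colex :: "nat \<Rightarrow> nat \<Rightarrow> (nat \<Rightarrow> nat) \<Rightarrow> nat set set" where
  "colex s 0 e = {}"
| "colex s (Suc j) e = [{..<j + e j}]\<^bsup>(Suc j + s)\<^esup> \<union> insert (j + e j) ` colex s j e"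

lemma card_nsets_lessThan: "card ([{..<n}]\<^bsup>k\<^esup>) = n choose k"
  unfolding lessThan_atLeast0 by (rule binomial_eq_nsets[symmetric])

lemma card_Un_insert_image:
  assumes "finite \<F>" "finite \<G>" "\<And>S. S \<in> \<F> \<union> \<G> \<Longrightarrow> w \<notin> S"
  shows "card (\<F> \<union> insert w ` \<G>) = card \<F> + card \<G>"
proof -
  have "inj_on (insert w) \<G>" using assms(3) by (auto simp: inj_on_def insert_ident)
  moreover have "\<F> \<inter> insert w ` \<G> = {}" using assms(3) by blast
  ultimately show ?thesis using assms by (simp add: card_Un_disjoint card_image)
qed

lemma shadow_Un: "shadow (\<F> \<union> \<G>) = shadow \<F> \<union> shadow \<G>"
  by (auto simp: shadow_def)

lemma shadow_insert_image_subset: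
  assumes "\<And>S. S \<in> \<F> \<Longrightarrow> w \<notin> S"
  shows "shadow (insert w ` \<F>) \<subseteq> \<F> \<union> insert w ` shadow \<F>"
proof
  fix T assume "T \<in> shadow (insert w ` \<F>)"
  then obtain S x where S: "S \<in> \<F>" and x: "x \<in> insert w S" "T = insert w S - {x}"
    by (elim shadow_memE imageE) simp
  show "T \<in> \<F> \<union> insert w ` shadow \<F>"
  proof (cases "x = w")
    case True
    then show ?thesis using S x assms by simp
  next
    case False
    then have "T = insert w (S - {x})" using x by auto
    then show ?thesis using False S x shadow_memI[of S \<F> x] by auto
  qed
qed

lemma finite_colex: "finite (colex s j e)"
  by (induction j) (simp_all add: finite_imp_finite_nsets)

lemma colex_subset_nsets:
  assumes "mono e"
  shows "colex s j e \<subseteq> [{..<j + e j}]\<^bsup>(j + s)\<^esup>"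
proof (induction j)
  case (Suc j)
  have "[{..<j + e j}]\<^bsup>(Suc j + s)\<^esup> \<subseteq> [{..<Suc j + e (Suc j)}]\<^bsup>(Suc j + s)\<^esup>"
    using monoD[OF assms, of j "Suc j"] by (intro nsets_mono) auto
  moreover have "insert (j + e j) S \<in> [{..<Suc j + e (Suc j)}]\<^bsup>(Suc j + s)\<^esup>" if "S \<in> colex s j e" for S
    using Suc that monoD[OF assms, of j "Suc j"] by (fastforce simp: nsets_def card_insert_if)
  ultimately show ?case by auto
qed simp

lemma colex_notin: "mono e \<Longrightarrow> S \<in> colex s j e \<Longrightarrow> j + e j \<le> w \<Longrightarrow> w \<notin> S"
  using colex_subset_nsets[of e s j] by (force simp: nsets_def)

lemma nsets_lessThan_notin: "S \<in> [{..<c}]\<^bsup>k\<^esup> \<Longrightarrow> c \<le> (w :: nat) \<Longrightarrow> w \<notin> S"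
  by (auto simp: nsets_def)

lemma card_colex:
  assumes "mono e"
  shows "card (colex s j e) = cascade s j e"
proof (induction j)
  case 0
  then show ?case by (simp add: cascade_def)
next
  case (Suc j)
  have "card (colex s (Suc j) e) = card ([{..<j + e j}]\<^bsup>(Suc j + s)\<^esup>) + card (colex s j e)"
    using nsets_lessThan_notin colex_notin[OF assms] unfolding colex.simps
    by (intro card_Un_insert_image finite_imp_finite_nsets finite_colex) auto
  then show ?case by (simp only: card_nsets_lessThan Suc) (simp add: cascade_def)
qed

lemma shadow_colex_subset:
  assumes "mono e"
  shows "shadow (colex (Suc s) j e) \<subseteq> colex s j e"
proof (induction j)
  case 0
  then show ?case by (simp add: shadow_def)
next
  case (Suc j)
  have "shadow ([{..<j + e j}]\<^bsup>(Suc j + Suc s)\<^esup>) \<subseteq> [{..<j + e j}]\<^bsup>(Suc j + s)\<^esup>"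
    by (intro shadow_subset_nsets) simp
  moreover have "shadow (insert (j + e j) ` colex (Suc s) j e)
      \<subseteq> colex (Suc s) j e \<union> insert (j + e j) ` shadow (colex (Suc s) j e)"
    using colex_notin[OF assms] by (intro shadow_insert_image_subset) blast
  moreover have "colex (Suc s) j e \<subseteq> [{..<j + e j}]\<^bsup>(Suc j + s)\<^esup>"
    using colex_subset_nsets[OF assms, of "Suc s" j] by simp
  ultimately show ?case using Suc unfolding colex.simps shadow_Un by blast
qed

lemma colex_1_subset_nsets: "mono e \<Longrightarrow> colex 1 j e \<subseteq> [UNIV]\<^bsup>Suc j\<^esup>"
  using colex_subset_nsets[of e 1 j] nsets_mono[of _ UNIV] by fastforce

lemma card_shadow_colex_le: "mono e \<Longrightarrow> card (shadow (colex (Suc s) j e)) \<le> cascade s j e"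
  using card_mono[OF finite_colex shadow_colex_subset] by (simp add: card_colex)

lemma obtain_choose_level:
  assumes "0 < (j :: nat)"
  obtains c where "c choose j \<le> n" "n < Suc c choose j"
proof -
  obtain i where i: "j = Suc i" using assms by (cases j) auto
  have "n < (n + Suc i) choose Suc i"
  proof (induction n)
    case (Suc n)
    have "0 < Suc (n + i) choose i" by simp
    moreover have "(Suc n + Suc i) choose Suc i = (Suc (n + i) choose i) + ((n + Suc i) choose Suc i)"
      by simp
    ultimately show ?case using Suc by linarith
  qed simp
  moreover have "\<not> n < 0 choose j" using i by simp
  ultimately show thesis
    using ex_least_nat_less[of "\<lambda>c. n < c choose j" "n + j"] that unfolding i
    by (metis Suc_eq_plus1 le_refl not_less)
qed

lemma le_of_choose_le: "a choose j \<le> n \<Longrightarrow> n < Suc c choose j \<Longrightarrow> a \<le> c"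
  by (metis binomial_right_mono leD le_trans not_less_eq_eq)

lemma cascade_exists:
  assumes "0 < j"
  shows "\<exists>e. mono e \<and> cascade 0 j e = n"
  using assms
proof (induction j arbitrary: n rule: nat_induct_non_zero)
  case 1
  show ?case by (rule exI[of _ "\<lambda>_. n"]) (simp add: mono_def cascade_def)
next
  case (Suc j)
  obtain c where c: "c choose Suc j \<le> n" "n < Suc c choose Suc j"
    by (rule obtain_choose_level[of "Suc j"]) auto
  then have "j \<le> c"
    using binomial_eq_0[of "Suc c" "Suc j"] by (metis Suc_less_eq not_less not_less_zero)
  obtain e where e: "mono e" "cascade 0 j e = n - (c choose Suc j)" using Suc.IH by blast
  obtain i where i: "j = Suc i" using Suc.hyps by (cases j) auto
  have "i + e i choose j \<le> cascade 0 j e" by (simp add: cascade_def i)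
  also have "\<dots> < c choose j" using c e by simp
  finally have "i + e i < c" by (metis binomial_right_mono not_le)
  then have e_le: "e t \<le> c - j" if "t < j" for t using monoD[OF e(1), of t i] that i by simp
  define e' where "e' t = (if t < j then e t else c - j)" for t
  have "mono e'" using e(1) e_le by (auto simp: e'_def mono_def)
  moreover have "cascade 0 (Suc j) e' = n" using e c \<open>j \<le> c\<close> by (simp add: cascade_def e'_def)
  ultimately show ?case by blast
qed

text \<open>Junk for \<open>j = 0 < n\<close>, where the families are arbitrary sets of singletons.\<close>

definition kk :: "nat \<Rightarrow> nat \<Rightarrow> nat" where
  "kk j n = Max {card \<F> |\<F> :: nat set set. finite \<F> \<and> \<F> \<subseteq> [UNIV]\<^bsup>Suc j\<^esup> \<and> card (shadow \<F>) \<le> n}"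

lemma kk_cascade:
  assumes "mono e"
  shows "kk j (cascade 0 j e) = cascade 1 j e"
  unfolding kk_def
proof (rule Max_eqI)
  let ?cards = "{card \<F> |\<F> :: nat set set. finite \<F> \<and> \<F> \<subseteq> [UNIV]\<^bsup>Suc j\<^esup> \<and>
    card (shadow \<F>) \<le> cascade 0 j e}"
  show "n \<le> cascade 1 j e" if "n \<in> ?cards" for n using that kruskal_katona[OF assms] by blast
  then show "finite ?cards" by (meson finite_nat_set_iff_bounded_le)
  show "cascade 1 j e \<in> ?cards"
  proof (intro CollectI exI conjI)
    show "cascade 1 j e = card (colex 1 j e)" by (rule card_colex[OF assms, symmetric])
    show "card (shadow (colex 1 j e)) \<le> cascade 0 j e" using card_shadow_colex_le[OF assms, of 0] by simp
  qed (rule finite_colex colex_1_subset_nsets[OF assms])+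
qed

lemma card_le_kk:
  assumes "0 < j" "finite \<F>" "\<F> \<subseteq> [UNIV]\<^bsup>Suc j\<^esup>" "card (shadow \<F>) \<le> n"
  shows "card \<F> \<le> kk j n"
  using cascade_exists[OF assms(1), of n] kruskal_katona[OF _ assms(2,3)] assms(4) kk_cascade by metis

lemma kk_mono:
  assumes "0 < j" "m \<le> n"
  shows "kk j m \<le> kk j n"
proof -
  obtain e where e: "mono e" "cascade 0 j e = m" using cascade_exists[OF assms(1)] by metis
  have "kk j m = card (colex 1 j e)" using kk_cascade[OF e(1), of j] card_colex[OF e(1)] e(2) by simp
  also have "\<dots> \<le> kk j n"
    using card_shadow_colex_le[OF e(1), of 0 j] e(2) assms(2)
    by (intro card_le_kk assms(1) finite_colex colex_1_subset_nsets e(1)) simp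
  finally show ?thesis .
qed

lemma cascade_less_choose:
  assumes "mono e"
  shows "cascade 0 (Suc i) e < Suc (i + e i) choose Suc i"
proof (induction i)
  case 0
  then show ?case by (simp add: cascade_def)
next
  case (Suc i)
  note Suc
  also have "Suc (i + e i) choose Suc i \<le> (Suc i + e (Suc i)) choose Suc i"
    using monoD[OF assms, of i "Suc i"] by (intro binomial_right_mono) auto
  finally show ?case by (simp add: cascade_def)
qed

lemma nsets_subset_colex:
  assumes "mono e" "0 < j" "c choose j \<le> cascade 0 j e"
  shows "[{..<c}]\<^bsup>j\<^esup> \<subseteq> colex 0 j e"
proof -
  obtain i where i: "j = Suc i" using assms(2) by (cases j) auto
  have "c \<le> i + e i"
    using le_of_choose_le[OF assms(3)] cascade_less_choose[OF assms(1)] by (simp only: i)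
  then have "[{..<c}]\<^bsup>j\<^esup> \<subseteq> [{..<i + e i}]\<^bsup>j\<^esup>" by (intro nsets_mono) auto
  then show ?thesis by (auto simp: i)
qed

text \<open>Join a new vertex \<open>w\<close> to all \<open>(j - 1)\<close>-subsets of \<open>{..<c}\<close> in the extremal family for \<open>m\<close>,
  whose shadow contains all \<open>j\<close>-subsets of \<open>{..<c}\<close>.\<close>

lemma kk_add_vertex:
  assumes "0 < j" "c choose j \<le> m"
  shows "kk j m + (c choose j) \<le> kk j (m + (c choose (j - 1)))"
proof -
  obtain e where e: "mono e" "cascade 0 j e = m" using cascade_exists assms(1) by blast
  define w where "w = j + e j + c"
  have fresh: "w \<notin> S" if "S \<in> colex s j e \<union> [{..<c}]\<^bsup>i\<^esup>" for S s i
    using that colex_notin[OF e(1)] nsets_lessThan_notin unfolding w_def by (auto simp: trans_le_add2)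
  have fin: "finite ([{..<c}]\<^bsup>i\<^esup>)" for i by (intro finite_imp_finite_nsets) simp
  let ?F = "colex 1 j e \<union> insert w ` [{..<c}]\<^bsup>j\<^esup>"
    and ?G = "colex 0 j e \<union> insert w ` [{..<c}]\<^bsup>(j - 1)\<^esup>"
  have "shadow (insert w ` [{..<c}]\<^bsup>j\<^esup>) \<subseteq> [{..<c}]\<^bsup>j\<^esup> \<union> insert w ` shadow ([{..<c}]\<^bsup>j\<^esup>)"
    using fresh by (intro shadow_insert_image_subset) blast
  moreover have "shadow ([{..<c}]\<^bsup>j\<^esup>) \<subseteq> [{..<c}]\<^bsup>(j - 1)\<^esup>"
    using assms(1) by (intro shadow_subset_nsets) simp
  moreover have "[{..<c}]\<^bsup>j\<^esup> \<subseteq> colex 0 j e"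
    using e assms by (intro nsets_subset_colex) simp_all
  moreover have "shadow (colex 1 j e) \<subseteq> colex 0 j e" using shadow_colex_subset[OF e(1), of 0 j] by simp
  ultimately have "shadow ?F \<subseteq> ?G" unfolding shadow_Un by blast
  then have "card (shadow ?F) \<le> card ?G" by (intro card_mono) (simp_all add: finite_colex fin)
  also have "\<dots> = m + (c choose (j - 1))"
    using fresh e
    by (subst card_Un_insert_image) (auto simp: finite_colex fin card_colex card_nsets_lessThan)
  finally have "card (shadow ?F) \<le> m + (c choose (j - 1))" .
  moreover have "insert w S \<in> [UNIV]\<^bsup>Suc j\<^esup>" if "S \<in> [{..<c}]\<^bsup>j\<^esup>" for S
    using that fresh[of S 0 j] by (auto simp: nsets_def)
  then have "?F \<subseteq> [UNIV]\<^bsup>Suc j\<^esup>" using colex_1_subset_nsets[OF e(1), of j] by blast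
  ultimately have "card ?F \<le> kk j (m + (c choose (j - 1)))"
    using assms(1) by (intro card_le_kk) (auto simp: finite_colex fin)
  moreover have "card ?F = kk j m + (c choose j)"
    using fresh e kk_cascade[OF e(1), of j]
    by (subst card_Un_insert_image) (auto simp: finite_colex fin card_colex card_nsets_lessThan)
  ultimately show ?thesis by simp
qed

lemma kk_add_vertices:
  assumes "0 < j" "c choose j \<le> m"
  shows "kk j m + p * (c choose j) \<le> kk j (m + p * (c choose (j - 1)))"
proof (induction p)
  case (Suc p)
  then show ?case using kk_add_vertex[OF assms(1), of c "m + p * (c choose (j - 1))"] assms(2)
    by (simp add: algebra_simps)
qed simp

lemma kk_choose:
  assumes "0 < j"
  shows "kk j (c choose j) = c choose Suc j"
proof (cases "j \<le> Suc c")
  case True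
  obtain i where i: "j = Suc i" using assms by (cases j) auto
  let ?e = "\<lambda>t. if t < i then 0 else c - i"
  have "mono ?e" by (auto simp: mono_def)
  moreover have "cascade 0 j ?e = c choose j" "cascade 1 j ?e = c choose Suc j"
    using True by (simp_all add: i cascade_def)
  ultimately show ?thesis using kk_cascade by metis
next
  case False
  have "mono (\<lambda>_::nat. 0::nat)" by (simp add: mono_def)
  from kk_cascade[OF this, of j] show ?thesis using False by (simp add: cascade_def binomial_eq_0)
qed

lemma kk_le_linear:
  assumes "0 < j" "n < Suc c choose j"
  shows "Suc j * kk j n \<le> Suc c * n"
proof -
  obtain a where a: "a choose j \<le> n" "n < Suc a choose j" by (rule obtain_choose_level[OF assms(1)])
  have "a \<le> c" by (rule le_of_choose_le[OF a(1) assms(2)])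
  have "Suc j * kk j n \<le> Suc j * kk j (Suc a choose j)"
    using a by (intro mult_le_mono2 kk_mono assms(1)) simp
  also have "\<dots> = Suc j * (Suc a choose Suc j)" by (simp add: kk_choose[OF assms(1)])
  also have "\<dots> = Suc a * (a choose j)" by (rule Suc_times_binomial)
  also have "\<dots> \<le> Suc c * n" using a \<open>a \<le> c\<close> by (intro mult_le_mono) auto
  finally show ?thesis .
qed

lemma binomial_pred_mult:
  assumes "0 < j"
  shows "(c choose (j - 1)) * (c - (j - 1)) = j * (c choose j)"
  using binomial_absorb_comp[of c "j - 1"] times_binomial_minus1_eq[OF assms, of c]
  by (simp add: mult.commute)

text \<open>Joining \<open>n div (c choose (j - 1))\<close> new vertices gains about \<open>n c / j\<close>, whereas \<open>kk j n\<close> is at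
  most about \<open>n c / (j + 1)\<close>.\<close>

lemma kk_gain:
  assumes j_pos: "0 < j" and m_ge: "c choose j \<le> m" and n_less: "n < Suc c choose j"
    and n_ge: "4 * (j + 1) * (c choose (j - 1)) \<le> n"
    and c_large: "4 * (j * (j + l * (j + 1))) + 2 * j \<le> c"
  shows "kk j m + kk j n + (Suc c choose j) + l * n \<le> kk j (m + n)"
proof -
  define q where "q = c choose (j - 1)"
  define Q where "Q = c choose j"
  define d where "d = c - (j - 1)"
  define p where "p = n div q"
  have q_mult_d: "q * d = j * Q" using binomial_pred_mult[OF j_pos] by (simp add: q_def Q_def d_def)
  have d_eq: "Suc c = d + j" "4 * (j * (j + l * (j + 1))) + j \<le> 2 * d"
    using c_large j_pos by (auto simp: d_def)
  have "0 < q" using c_large by (simp add: q_def)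
  then have pq: "p * q \<le> n" "n \<le> p * q + q"
    using div_mult_mod_eq[of n q] mod_less_divisor[of q n] unfolding p_def by linarith+
  have linear: "(j + 1) * kk j n \<le> (d + j) * n" using kk_le_linear[OF j_pos n_less] d_eq by simp
  have q_le: "4 * (j + 1) * q \<le> n" using n_ge by (simp add: q_def)
  have "4 * ((j + 1) * (j * (kk j n + q + l * n) + 2 * (q * d)))
      = 4 * j * ((j + 1) * kk j n) + 4 * (j + 1) * q * (2 * d + j) + 4 * (j * (l * (j + 1))) * n"
    by (simp add: algebra_simps)
  also have "\<dots> \<le> 4 * j * ((d + j) * n) + n * (2 * d + j) + 4 * (j * (l * (j + 1))) * n"
    by (intro add_mono mult_le_mono2[OF linear] mult_le_mono1[OF q_le] order_refl)
  also have "\<dots> = n * (4 * (j * (j + l * (j + 1))) + j) + n * (4 * j * d + 2 * d)"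
    by (simp add: algebra_simps)
  also have "\<dots> \<le> n * (2 * d) + n * (4 * j * d + 2 * d)"
    using d_eq by (intro add_mono mult_le_mono) auto
  also have "\<dots> = 4 * ((j + 1) * (n * d))" by (simp add: algebra_simps)
  also have "\<dots> \<le> 4 * ((j + 1) * ((p * q + q) * d))" using pq by (intro mult_le_mono) auto
  finally have "j * (kk j n + q + l * n) + 2 * (q * d) \<le> (p * q + q) * d"
    by (simp only: mult_le_cancel1)
  then have "j * (kk j n + q + l * n) + q * d \<le> p * (q * d)" by (simp add: algebra_simps)
  then have "j * (kk j n + Q + q + l * n) \<le> j * (p * Q)" unfolding q_mult_d by (simp add: algebra_simps)
  then have "kk j n + Q + q + l * n \<le> p * Q" using j_pos by simp
  moreover have "kk j m + p * Q \<le> kk j (m + p * q)"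
    unfolding Q_def q_def by (rule kk_add_vertices[OF j_pos m_ge])
  moreover have "kk j (m + p * q) \<le> kk j (m + n)" using pq by (intro kk_mono j_pos) simp
  moreover have "Suc c choose j = Q + q" unfolding Q_def q_def using j_pos by (cases j) auto
  ultimately show ?thesis by linarith
qed

section \<open>Profitable splits and minimum degrees\<close>

lemma eventually_choose_level:
  assumes "\<forall>\<^sub>F c in sequentially. P c"
  shows "\<forall>\<^sub>F n in sequentially. \<forall>c. n < Suc c choose j \<longrightarrow> P c"
proof -
  obtain c0 where c0: "\<And>c. c0 \<le> c \<Longrightarrow> P c" using assms by (auto simp: eventually_sequentially)
  show ?thesis
    using eventually_ge_at_top[of "c0 choose j"] by eventually_elim (blast intro: c0 le_of_choose_le)
qed

lemma eventually_binomial_pred_le: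
  assumes "0 < j"
  shows "\<forall>\<^sub>F c in sequentially. K * (c choose (j - 1)) \<le> c choose j"
  using eventually_ge_at_top[of "j * K + j"]
proof eventually_elim
  case (elim c)
  have "j * (K * (c choose (j - 1))) = (c choose (j - 1)) * (j * K)" by simp
  also have "\<dots> \<le> (c choose (j - 1)) * (c - (j - 1))" using elim by (intro mult_le_mono2) simp
  also have "\<dots> = j * (c choose j)" by (rule binomial_pred_mult[OF assms])
  finally show ?case using assms by simp
qed

definition profitable_split :: "nat \<Rightarrow> nat \<Rightarrow> nat \<Rightarrow> nat \<Rightarrow> bool" where
  "profitable_split j l m n \<longleftrightarrow>
    0 < m \<and> 0 < n \<and> kk j m + kk j n + n + l * min m n \<le> kk j (m + n)"

lemma eventually_kk_gain:
  assumes "0 < j"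
  shows "\<forall>\<^sub>F n in sequentially. \<forall>c p q. n < Suc c choose j \<longrightarrow> c choose j \<le> p \<longrightarrow>
    q < Suc c choose j \<longrightarrow> 4 * (j + 1) * (c choose (j - 1)) \<le> q \<longrightarrow>
    kk j p + kk j q + (Suc c choose j) + l * q \<le> kk j (p + q)"
  using eventually_choose_level[OF eventually_ge_at_top[of "4 * (j * (j + l * (j + 1))) + 2 * j"], of j]
  by eventually_elim (use kk_gain[OF assms] in blast)

lemma eventually_profitable_split_of_ge:
  assumes "0 < j"
  shows "\<forall>\<^sub>F n in sequentially. \<forall>m\<ge>n. profitable_split j l m n"
  using eventually_gt_at_top[of 0] eventually_kk_gain[OF assms, of l]
    eventually_choose_level[OF eventually_binomial_pred_le[OF assms, of "4 * (j + 1)"], of j]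
proof eventually_elim
  case (elim n)
  show ?case
  proof (intro allI impI)
    fix m assume "n \<le> m"
    obtain c where c: "c choose j \<le> n" "n < Suc c choose j" by (rule obtain_choose_level[OF assms])
    then have "kk j m + kk j n + (Suc c choose j) + l * n \<le> kk j (m + n)"
      using elim \<open>n \<le> m\<close> by (meson le_trans)
    then show "profitable_split j l m n"
      using c elim(1) \<open>n \<le> m\<close> by (simp add: profitable_split_def min_absorb2)
  qed
qed

lemma eventually_profitable_split_of_le:
  assumes "0 < j"
  shows "\<forall>\<^sub>F n in sequentially. \<forall>m\<le>n. \<forall>c. n < Suc c choose j \<longrightarrow>
    4 * (j + 1) * (c choose (j - 1)) < m \<longrightarrow> profitable_split j l m n"
  using eventually_gt_at_top[of 0] eventually_kk_gain[OF assms, of l]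
proof eventually_elim
  case (elim n)
  show ?case
  proof (intro allI impI)
    fix m c assume m: "m \<le> n" "4 * (j + 1) * (c choose (j - 1)) < m" and n_less: "n < Suc c choose j"
    obtain a where a: "a choose j \<le> n" "n < Suc a choose j" by (rule obtain_choose_level[OF assms])
    have "a \<le> c" by (rule le_of_choose_le[OF a(1) n_less])
    then have "4 * (j + 1) * (a choose (j - 1)) \<le> 4 * (j + 1) * (c choose (j - 1))"
      by (intro mult_le_mono2 binomial_right_mono)
    then have "kk j n + kk j m + (Suc a choose j) + l * m \<le> kk j (n + m)"
      using elim(2) a m by (meson le_less_trans le_trans less_imp_le)
    then show "profitable_split j l m n"
      using a m elim(1) by (simp add: profitable_split_def min_absorb1 add.commute)
  qed
qed

lemma mult_pow_pred_less_pow: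
  fixes x y K E :: nat
  assumes "0 < j" "x \<le> K * y" "K ^ j * E < x"
  shows "E * x ^ (j - 1) < y ^ j"
proof (rule ccontr)
  assume "\<not> E * x ^ (j - 1) < y ^ j"
  then have y_le: "y ^ j \<le> E * x ^ (j - 1)" by simp
  have "x ^ (j - 1) * x \<le> K ^ j * y ^ j"
    using power_mono[OF assms(2), of j] power_minus_mult[OF assms(1), of x]
    by (simp add: power_mult_distrib)
  also have "\<dots> \<le> K ^ j * (E * x ^ (j - 1))" by (intro mult_le_mono2 y_le)
  also have "\<dots> = x ^ (j - 1) * (K ^ j * E)" by (simp only: mult_ac)
  finally show False using assms(3) by (auto simp: mult_le_cancel1)
qed

lemma average_degree_less:
  assumes "0 < j" "4 * (j + 1) * d \<le> c - j" "K < d" "2 * j \<le> c" "b < Suc c choose j"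
  shows "d * b + K < c choose Suc j"
proof -
  define Q where "Q = c choose j"
  have "0 < Q" using assms(4) by (simp add: Q_def)
  have pred: "(c choose (j - 1)) * (c - (j - 1)) = j * Q"
    unfolding Q_def by (rule binomial_pred_mult[OF assms(1)])
  have "(c choose (j - 1)) * j \<le> (c choose (j - 1)) * (c - (j - 1))"
    using assms(4) by (intro mult_le_mono2) simp
  then have "c choose (j - 1) \<le> Q" unfolding pred using assms(1) by simp
  moreover have "Suc c choose j = Q + (c choose (j - 1))"
    using assms(1) by (cases j) (simp_all add: Q_def)
  ultimately have "b \<le> 2 * Q" using assms(5) by simp
  then have "d * b \<le> 2 * (d * Q)" using mult_le_mono2[of b "2 * Q" d] by simp
  moreover have "d \<le> d * Q" using \<open>0 < Q\<close> by simp
  moreover have "(j + 1) * (4 * d * Q) \<le> (j + 1) * (c choose Suc j)"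
    using mult_le_mono1[OF assms(2), of Q] binomial_pred_mult[of "Suc j" c]
    by (simp add: Q_def algebra_simps)
  then have "4 * d * Q \<le> c choose Suc j" by (simp only: mult_le_cancel1)
  ultimately show ?thesis using assms(3) by linarith
qed

text \<open>In a family of \<open>c choose (j + 1)\<close> sets some minimum degree \<open>d\<close> of order \<open>c\<close> can be enforced,
  while \<open>d ^ j\<close> still beats \<open>c choose (j - 1)\<close>.\<close>

lemma eventually_min_degree_exists:
  assumes "0 < j"
  shows "\<forall>\<^sub>F c in sequentially. \<exists>d. (\<forall>b. b < Suc c choose j \<longrightarrow> d * b + K < c choose Suc j) \<and>
    E * (c choose (j - 1)) < (Suc d - j) ^ j"
  using eventually_ge_at_top[of "j + 4 * (j + 1) * (K + 1)"]
    eventually_ge_at_top[of "2 * j + 8 * j * (j + 1)"]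
    eventually_gt_at_top[of "(8 * (j + 1)) ^ j * E"]
proof eventually_elim
  case (elim c)
  define d where "d = (c - j) div (4 * (j + 1))"
  have "Suc K \<le> d"
    unfolding d_def using elim(1)
    by (subst less_eq_div_iff_mult_less_eq) (simp_all add: algebra_simps)
  moreover have "4 * (j + 1) * d \<le> c - j" unfolding d_def by (rule times_div_less_eq_dividend)
  moreover have "E * (c choose (j - 1)) < (Suc d - j) ^ j"
  proof -
    have "c - j < 4 * (j + 1) * Suc d"
      unfolding d_def using dividend_less_times_div[of "4 * (j + 1)" "c - j"] by simp
    then have "c \<le> 8 * (j + 1) * (Suc d - j)"
      using elim(2) by (simp add: diff_mult_distrib2 algebra_simps)
    then have "E * c ^ (j - 1) < (Suc d - j) ^ j"
      using elim(3) by (rule mult_pow_pred_less_pow[OF assms])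
    moreover have "c choose (j - 1) \<le> c ^ (j - 1)" using elim(2) by (intro binomial_le_pow) simp
    ultimately show ?thesis by (meson le_less_trans mult_le_mono2)
  qed
  ultimately show ?case
    using average_degree_less[OF assms, of d c K] elim(2) by (intro exI[of _ d]) (simp add: Suc_le_eq)
qed

section \<open>Partial shadow systems\<close>

definition sets_below :: "'a set set \<Rightarrow> 'a set \<Rightarrow> 'a set set" where
  "sets_below \<F> S = {T\<in>\<F>. T \<subseteq> S}"

definition sets_above :: "'a set set \<Rightarrow> 'a set \<Rightarrow> 'a set set" where
  "sets_above \<F> X = {S\<in>\<F>. X \<subseteq> S}"

definition sets_not_above :: "'a set set \<Rightarrow> 'a set \<Rightarrow> 'a set set" where
  "sets_not_above \<F> X = {S\<in>\<F>. \<not> X \<subseteq> S}"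

definition confined :: "'a set set \<Rightarrow> 'a set set \<Rightarrow> 'a set \<Rightarrow> 'a set set" where
  "confined \<A> \<B> X = {S\<in>\<A>. sets_below \<B> S \<subseteq> sets_above \<B> X}"

lemma card_sets_above_not_above:
  assumes "finite \<F>"
  shows "card \<F> = card (sets_above \<F> X) + card (sets_not_above \<F> X)"
proof -
  have "\<F> = sets_above \<F> X \<union> sets_not_above \<F> X"
    by (auto simp: sets_above_def sets_not_above_def)
  also have "card \<dots> = card (sets_above \<F> X) + card (sets_not_above \<F> X)"
    using assms by (intro card_Un_disjoint) (auto simp: sets_above_def sets_not_above_def)
  finally show ?thesis .
qed

text \<open>The pairs in the definition of \<open>f(r + 1, j + 1, |\<B>|)\<close>.\<close>

locale partial_shadow =
  fixes r j :: nat and \<A> \<B> :: "'a set set"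
  assumes finite_upper: "finite \<A>"
    and finite_lower: "finite \<B>"
    and upper_subset: "\<A> \<subseteq> [UNIV]\<^bsup>Suc r\<^esup>"
    and lower_subset: "\<B> \<subseteq> [UNIV]\<^bsup>r\<^esup>"
    and many_below: "S \<in> \<A> \<Longrightarrow> j < card (sets_below \<B> S)"
begin

lemma finite_upper_set: "S \<in> \<A> \<Longrightarrow> finite S"
  using upper_subset by (auto simp: nsets_def)

lemma card_upper_set: "S \<in> \<A> \<Longrightarrow> card S = Suc r"
  using upper_subset by (auto simp: nsets_def)

lemma finite_lower_set: "T \<in> \<B> \<Longrightarrow> finite T"
  using lower_subset by (auto simp: nsets_def)

lemma card_lower_set: "T \<in> \<B> \<Longrightarrow> card T = r"
  using lower_subset by (auto simp: nsets_def)

lemma upper_eq_insert: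
  assumes "S \<in> \<A>" "T \<in> sets_below \<B> S"
  obtains u where "u \<in> S" "u \<notin> T" "S = insert u T" "T = S - {u}"
proof -
  have T: "T \<in> \<B>" "T \<subseteq> S" using assms(2) by (auto simp: sets_below_def)
  then have "card (S - T) = 1"
    using finite_lower_set[OF T(1)] card_upper_set[OF assms(1)] card_lower_set[OF T(1)]
    by (simp add: card_Diff_subset)
  then obtain u where "S - T = {u}" by (auto simp: card_1_singleton_iff)
  then show thesis using that[of u] T(2) by blast
qed

lemma upper_eq_Un:
  assumes "S \<in> \<A>" "T \<in> sets_below \<B> S" "X \<subseteq> S" "\<not> X \<subseteq> T"
  shows "S = T \<union> X"
  by (rule upper_eq_insert[OF assms(1,2)]) (use assms(3,4) in blast)

lemma sets_below_subset_remove_image: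
  assumes "S \<in> \<A>"
  shows "sets_below \<B> S \<subseteq> (\<lambda>x. S - {x}) ` S"
proof
  fix T assume "T \<in> sets_below \<B> S"
  then obtain u where "u \<in> S" "T = S - {u}" using upper_eq_insert[OF assms] by metis
  then show "T \<in> (\<lambda>x. S - {x}) ` S" by blast
qed

lemma sets_below_nonempty: "S \<in> \<A> \<Longrightarrow> sets_below \<B> S \<noteq> {}"
  using many_below by fastforce

lemma subset_upper_set: "S \<in> \<A> \<Longrightarrow> (\<And>T. T \<in> \<B> \<Longrightarrow> X \<subseteq> T) \<Longrightarrow> X \<subseteq> S"
  using sets_below_nonempty by (fastforce simp: sets_below_def)

lemma card_upper_le_square:
  assumes "0 < j"
  shows "card \<A> \<le> card \<B> * card \<B>"
proof -
  have "\<A> \<subseteq> (\<lambda>(T, T'). T \<union> T') ` (\<B> \<times> \<B>)"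
  proof
    fix S assume S: "S \<in> \<A>"
    have "\<not> card (sets_below \<B> S) \<le> Suc 0" using many_below[OF S] assms by simp
    then obtain T T' where T: "T \<in> sets_below \<B> S" "T' \<in> sets_below \<B> S" "T \<noteq> T'"
      using card_le_Suc0_iff_eq[of "sets_below \<B> S"] finite_lower by (auto simp: sets_below_def)
    then have "\<not> T' \<subseteq> T"
      using card_subset_eq[of T T'] finite_lower_set card_lower_set by (auto simp: sets_below_def)
    then have "S = T \<union> T'" using upper_eq_Un[OF S T(1)] T(2) by (auto simp: sets_below_def)
    then show "S \<in> (\<lambda>(T, T'). T \<union> T') ` (\<B> \<times> \<B>)" using T by (auto simp: sets_below_def)
  qed
  then have "card \<A> \<le> card (\<B> \<times> \<B>)" using finite_lower by (intro surj_card_le) simp_all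
  then show ?thesis by (simp add: card_cartesian_product)
qed

lemma restrict:
  assumes "\<A>' \<subseteq> \<A>" "\<B>' \<subseteq> \<B>" "\<And>S. S \<in> \<A>' \<Longrightarrow> sets_below \<B> S \<subseteq> \<B>'"
  shows "partial_shadow r j \<A>' \<B>'"
proof
  show "finite \<A>'" "finite \<B>'" using assms(1,2) finite_upper finite_lower finite_subset by blast+
  show "\<A>' \<subseteq> [UNIV]\<^bsup>Suc r\<^esup>" "\<B>' \<subseteq> [UNIV]\<^bsup>r\<^esup>" using assms(1,2) upper_subset lower_subset by blast+
  fix S assume S: "S \<in> \<A>'"
  have "sets_below \<B>' S = sets_below \<B> S" using assms(2) assms(3)[OF S] by (auto simp: sets_below_def)
  then show "j < card (sets_below \<B>' S)" using many_below[of S] assms(1) S by auto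
qed

lemma partial_shadow_confined: "partial_shadow r j (confined \<A> \<B> X) (sets_above \<B> X)"
  by (rule restrict) (auto simp: confined_def sets_above_def)

lemma partial_shadow_sets_not_above: "partial_shadow r j (sets_not_above \<A> X) (sets_not_above \<B> X)"
  by (rule restrict) (auto simp: sets_not_above_def sets_below_def)

lemma card_upper_split_le:
  "card \<A> \<le> card (confined \<A> \<B> X) + card (sets_not_above \<A> X) + card (sets_not_above \<B> X)"
proof -
  let ?joined = "(\<lambda>T. T \<union> X) ` sets_not_above \<B> X"
  have "\<A> \<subseteq> confined \<A> \<B> X \<union> sets_not_above \<A> X \<union> ?joined"
  proof
    fix S assume S: "S \<in> \<A>"
    consider (outside) "\<not> X \<subseteq> S" | (confined) "S \<in> confined \<A> \<B> X"
      | (mixed) T where "T \<in> sets_below \<B> S" "\<not> X \<subseteq> T" "X \<subseteq> S"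
      using S by (auto simp: confined_def sets_above_def sets_below_def)
    then show "S \<in> confined \<A> \<B> X \<union> sets_not_above \<A> X \<union> ?joined"
    proof cases
      case (mixed T)
      then have "S = T \<union> X" "T \<in> sets_not_above \<B> X"
        using upper_eq_Un[OF S] by (simp_all add: sets_not_above_def sets_below_def)
      then show ?thesis by blast
    qed (use S in \<open>simp_all add: sets_not_above_def\<close>)
  qed
  moreover have "finite (confined \<A> \<B> X \<union> sets_not_above \<A> X \<union> ?joined)"
    using finite_upper finite_lower by (simp add: confined_def sets_not_above_def)
  ultimately have "card \<A> \<le> card (confined \<A> \<B> X \<union> sets_not_above \<A> X \<union> ?joined)"
    by (rule card_mono[rotated])
  also have "\<dots> \<le> card (confined \<A> \<B> X) + card (sets_not_above \<A> X) + card ?joined"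
    by (meson add_right_mono card_Un_le le_trans)
  also have "card ?joined \<le> card (sets_not_above \<B> X)"
    using finite_lower by (intro card_image_le) (simp add: sets_not_above_def)
  finally show ?thesis by simp
qed

lemma card_upper_le_confined:
  assumes "0 < j" "card (sets_not_above \<B> X) < N"
  shows "card \<A> \<le> card (confined \<A> \<B> X) + (N * N + N)"
proof -
  interpret outside: partial_shadow r j "sets_not_above \<A> X" "sets_not_above \<B> X"
    by (rule partial_shadow_sets_not_above)
  have "card (sets_not_above \<A> X) \<le> card (sets_not_above \<B> X) * card (sets_not_above \<B> X)"
    by (rule outside.card_upper_le_square[OF assms(1)])
  also have "\<dots> \<le> N * N" using assms(2) by (intro mult_le_mono) simp_all
  finally show ?thesis using card_upper_split_le[of X] assms(2) by linarith
qed

lemma partial_shadow_Diff: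
  assumes "finite X" "\<And>T. T \<in> \<B> \<Longrightarrow> X \<subseteq> T"
  shows "partial_shadow (r - card X) j ((\<lambda>S. S - X) ` \<A>) ((\<lambda>T. T - X) ` \<B>)"
proof
  show "finite ((\<lambda>S. S - X) ` \<A>)" "finite ((\<lambda>T. T - X) ` \<B>)"
    using finite_upper finite_lower by simp_all
  show "(\<lambda>T. T - X) ` \<B> \<subseteq> [UNIV]\<^bsup>(r - card X)\<^esup>"
    using assms finite_lower_set card_lower_set by (auto simp: nsets_def card_Diff_subset)
  have card_X_le: "card X \<le> r" if "S \<in> \<A>" for S
    using sets_below_nonempty[OF that] assms(2) card_mono[OF finite_lower_set] card_lower_set
    by (fastforce simp: sets_below_def)
  show "(\<lambda>S. S - X) ` \<A> \<subseteq> [UNIV]\<^bsup>Suc (r - card X)\<^esup>"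
    using card_X_le subset_upper_set[OF _ assms(2)] assms(1) finite_upper_set card_upper_set
    by (auto simp: nsets_def card_Diff_subset Suc_diff_le)
  fix R assume "R \<in> (\<lambda>S. S - X) ` \<A>"
  then obtain S where S: "S \<in> \<A>" and R: "R = S - X" by blast
  have "inj_on (\<lambda>T. T - X) (sets_below \<B> S)"
    by (rule inj_on_inverseI[where g = "\<lambda>T. T \<union> X"]) (use assms(2) in \<open>auto simp: sets_below_def\<close>)
  then have "card (sets_below \<B> S) \<le> card (sets_below ((\<lambda>T. T - X) ` \<B>) R)"
    by (rule card_inj_on_le) (use finite_lower in \<open>auto simp: sets_below_def R\<close>)
  then show "j < card (sets_below ((\<lambda>T. T - X) ` \<B>) R)" using many_below[OF S] by simp
qed

lemma shadow_upper_subset: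
  assumes "r = j"
  shows "shadow \<A> \<subseteq> \<B>"
proof
  fix T assume "T \<in> shadow \<A>"
  then obtain S x where S: "S \<in> \<A>" "x \<in> S" and T: "T = S - {x}" by (rule shadow_memE)
  note fin = finite_upper_set[OF S(1)]
  have "card ((\<lambda>x. S - {x}) ` S) \<le> Suc r"
    using card_image_le[OF fin, of "\<lambda>x. S - {x}"] card_upper_set[OF S(1)] by simp
  then have "sets_below \<B> S = (\<lambda>x. S - {x}) ` S"
    using many_below[OF S(1)] fin assms sets_below_subset_remove_image[OF S(1)]
    by (intro card_seteq) simp_all
  then show "T \<in> \<B>" using S(2) unfolding T sets_below_def by blast
qed

lemma card_upper_le_kk:
  assumes "0 < j" "j \<le> r" "finite X" "card X = r - j" and X: "\<And>T. T \<in> \<B> \<Longrightarrow> X \<subseteq> T"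
  shows "card \<A> \<le> kk j (card \<B>)"
proof -
  interpret link: partial_shadow j j "(\<lambda>S. S - X) ` \<A>" "(\<lambda>T. T - X) ` \<B>"
    using partial_shadow_Diff[OF assms(3) X] assms(2,4) by simp
  have "inj_on (\<lambda>S. S - X) \<A>"
    by (rule inj_on_inverseI[where g = "\<lambda>S. S \<union> X"]) (use subset_upper_set[OF _ X] in auto)
  then have "card \<A> = card ((\<lambda>S. S - X) ` \<A>)" by (simp add: card_image)
  also have "\<dots> \<le> kk j (card \<B>)"
  proof (rule card_le_kk[OF assms(1) link.finite_upper link.upper_subset])
    have "card (shadow ((\<lambda>S. S - X) ` \<A>)) \<le> card ((\<lambda>T. T - X) ` \<B>)"
      by (rule card_mono[OF link.finite_lower link.shadow_upper_subset[OF refl]])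
    also have "\<dots> \<le> card \<B>" by (rule card_image_le[OF finite_lower])
    finally show "card (shadow ((\<lambda>S. S - X) ` \<A>)) \<le> card \<B>" .
  qed
  finally show ?thesis .
qed

end

lemma obtain_min_degree_subsystem:
  assumes "partial_shadow r j \<A> \<B>" "d * card \<B> < card \<A>"
  obtains \<A>' \<B>' where "\<A>' \<subseteq> \<A>" "\<B>' \<subseteq> \<B>" "partial_shadow r j \<A>' \<B>'" "\<B>' \<noteq> {}"
    "\<And>T. T \<in> \<B>' \<Longrightarrow> d < card (sets_above \<A>' T)"
  using assms
proof (induction "card \<B>" arbitrary: \<A> \<B> thesis rule: less_induct)
  case less
  interpret partial_shadow r j \<A> \<B> by (rule less.prems(2))
  show ?case
  proof (cases "\<forall>T\<in>\<B>. d < card (sets_above \<A> T)")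
    case True
    obtain S where "S \<in> \<A>" using less.prems(3) by fastforce
    then have "\<B> \<noteq> {}" using sets_below_nonempty by (auto simp: sets_below_def)
    then show ?thesis
      using True less.prems(1)[OF subset_refl subset_refl partial_shadow_axioms] by blast
  next
    case False
    then obtain T where T: "T \<in> \<B>" "card (sets_above \<A> T) \<le> d" by (auto simp: not_less)
    have sys: "partial_shadow r j (sets_not_above \<A> T) (\<B> - {T})"
      by (rule restrict) (auto simp: sets_not_above_def sets_below_def)
    have card_B: "card \<B> = Suc (card (\<B> - {T}))"
      using T(1) finite_lower by (rule card.remove[rotated])
    then have "d * card (\<B> - {T}) < card (sets_not_above \<A> T)"
      using less.prems(3) T(2) card_sets_above_not_above[OF finite_upper, of T] by simp
    then obtain \<A>' \<B>' where sub: "\<A>' \<subseteq> sets_not_above \<A> T" "\<B>' \<subseteq> \<B> - {T}"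
      and sys': "partial_shadow r j \<A>' \<B>'" "\<B>' \<noteq> {}" "\<And>T. T \<in> \<B>' \<Longrightarrow> d < card (sets_above \<A>' T)"
      using less.hyps[OF _ _ sys] card_B by (metis lessI)
    show ?thesis
      by (rule less.prems(1)[OF _ _ sys']) (use sub in \<open>auto simp: sets_not_above_def\<close>)
  qed
qed

section \<open>Layers around a fixed set\<close>

definition layer :: "'a set set \<Rightarrow> 'a set \<Rightarrow> nat \<Rightarrow> 'a set set" where
  "layer \<B> B0 i = {T\<in>\<B>. card (B0 - T) = i}"

definition exchange :: "'a set \<Rightarrow> 'a set \<Rightarrow> 'a set \<Rightarrow> bool" where
  "exchange B0 T T' \<longleftrightarrow> (\<exists>y\<in>T' - B0. \<exists>u\<in>B0 - T'. T = insert u (T' - {y}))"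

lemma
  assumes "finite B0" "finite T'"
  shows finite_exchange: "finite {T. exchange B0 T T'}"
    and card_exchange_le: "card {T. exchange B0 T T'} \<le> card (T' - B0) * card (B0 - T')"
proof -
  have exchanges_eq: "{T. exchange B0 T T'} = (\<lambda>(y, u). insert u (T' - {y})) ` ((T' - B0) \<times> (B0 - T'))"
    by (auto simp: exchange_def)
  show "finite {T. exchange B0 T T'}" unfolding exchanges_eq using assms by simp
  show "card {T. exchange B0 T T'} \<le> card (T' - B0) * card (B0 - T')"
    unfolding exchanges_eq card_cartesian_product[symmetric] using assms by (intro card_image_le) simp
qed

context partial_shadow
begin

lemma finite_layer: "finite (layer \<B> B0 i)"
  using finite_lower by (simp add: layer_def)

lemma card_Diff_layer:
  assumes "B0 \<in> \<B>" "T \<in> layer \<B> B0 i"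
  shows "card (T - B0) = i"
proof -
  have T: "T \<in> \<B>" "card (B0 - T) = i" using assms(2) by (auto simp: layer_def)
  have "card (T - B0) = card (B0 - T)"
    using T(1) assms(1) finite_lower_set card_lower_set by (intro antisym card_le_sym_Diff) auto
  then show ?thesis using T(2) by simp
qed

text \<open>Adding \<open>y\<close> leaves only \<open>i + 1 \<le> j\<close> elements outside \<open>B0\<close>, so some member of \<open>\<B>\<close>
  contained in the enlarged set omits an element of \<open>B0\<close>.\<close>

lemma ex_exchange:
  assumes B0: "B0 \<in> \<B>" and T: "T \<in> layer \<B> B0 i" and i_less: "i < j"
    and S: "S \<in> \<A>" and y: "S = insert y T" "y \<notin> T" "y \<notin> B0"
  shows "\<exists>T'\<in>layer \<B> B0 (Suc i). exchange B0 T T' \<and> S = T \<union> T'"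
proof -
  have fin: "finite S" "finite B0" "finite T"
    using finite_upper_set[OF S] finite_lower_set[OF B0] y by simp_all
  have card_T: "card (B0 - T) = i" using T by (simp add: layer_def)
  have "S - B0 = insert y (T - B0)" using y by blast
  then have "card (S - B0) = Suc i" using y fin card_Diff_layer[OF B0 T] by simp
  then have "card ((\<lambda>u. S - {u}) ` (S - B0)) \<le> Suc i"
    using card_image_le[of "S - B0" "\<lambda>u. S - {u}"] fin by simp
  then have "card ((\<lambda>u. S - {u}) ` (S - B0)) < card (sets_below \<B> S)"
    using many_below[OF S] i_less by simp
  then have "\<not> sets_below \<B> S \<subseteq> (\<lambda>u. S - {u}) ` (S - B0)"
    using card_mono[of "(\<lambda>u. S - {u}) ` (S - B0)" "sets_below \<B> S"] fin by auto
  then obtain T' where T': "T' \<in> sets_below \<B> S" "T' \<notin> (\<lambda>u. S - {u}) ` (S - B0)" by blast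
  obtain u where u: "u \<in> S" "u \<notin> T'" "T' = S - {u}" by (rule upper_eq_insert[OF S T'(1)])
  then have u_B0: "u \<in> B0" "u \<noteq> y" using T'(2) y(3) by blast+
  have "B0 - T' = insert u (B0 - T)" unfolding u(3) y(1) using u_B0 y(3) by auto
  moreover have "u \<notin> B0 - T" using u u_B0 y by blast
  ultimately have "card (B0 - T') = Suc i" using card_T fin by simp
  then have "T' \<in> layer \<B> B0 (Suc i)" using T'(1) by (simp add: layer_def sets_below_def)
  moreover have "y \<in> T' - B0" "u \<in> B0 - T'" "T = insert u (T' - {y})" using u u_B0 y by blast+
  then have "exchange B0 T T'" unfolding exchange_def by blast
  moreover have "S = T \<union> T'" using u u_B0 y by blast
  ultimately show ?thesis by blast
qed

lemma card_exchange_ge: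
  assumes B0: "B0 \<in> \<B>" and T: "T \<in> layer \<B> B0 i" and i_less: "i < j"
    and degree: "d \<le> card (sets_above \<A> T)"
  shows "d - i \<le> card {T'\<in>layer \<B> B0 (Suc i). exchange B0 T T'}"
proof -
  let ?into = "(\<lambda>y. insert y T) ` (B0 - T)"
  have TB: "T \<in> \<B>" "card (B0 - T) = i" using T by (auto simp: layer_def)
  have "finite (B0 - T)" using finite_lower_set[OF B0] by simp
  then have "card ?into \<le> i" "finite ?into"
    using card_image_le[of "B0 - T" "\<lambda>y. insert y T"] TB(2) by simp_all
  then have enough: "d - i \<le> card (sets_above \<A> T - ?into)"
    using degree diff_card_le_card_Diff[of ?into "sets_above \<A> T"] by simp
  have "\<exists>T'\<in>layer \<B> B0 (Suc i). exchange B0 T T' \<and> S = T \<union> T'"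
    if S: "S \<in> sets_above \<A> T - ?into" for S
  proof -
    have S': "S \<in> \<A>" "T \<in> sets_below \<B> S" using S TB(1) by (auto simp: sets_above_def sets_below_def)
    then obtain y where y: "y \<notin> T" "S = insert y T" by (rule upper_eq_insert)
    then have "y \<notin> B0" using S by blast
    then show ?thesis by (rule ex_exchange[OF B0 T i_less S'(1) y(2,1)])
  qed
  then obtain h where h: "\<And>S. S \<in> sets_above \<A> T - ?into \<Longrightarrow>
    h S \<in> layer \<B> B0 (Suc i) \<and> exchange B0 T (h S) \<and> S = T \<union> h S" by metis
  then have "inj_on h (sets_above \<A> T - ?into)"
    by (intro inj_on_inverseI[where g = "\<lambda>S. T \<union> S"]) metis
  then have "card (sets_above \<A> T - ?into) \<le> card {T'\<in>layer \<B> B0 (Suc i). exchange B0 T T'}"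
    using h finite_layer by (intro card_inj_on_le) auto
  then show ?thesis using enough by simp
qed

lemma card_layer_Suc_ge:
  assumes B0: "B0 \<in> \<B>" and i_less: "i < j"
    and degree: "\<And>T. T \<in> \<B> \<Longrightarrow> d \<le> card (sets_above \<A> T)"
  shows "card (layer \<B> B0 i) * (d - i) \<le> card (layer \<B> B0 (Suc i)) * (Suc i)\<^sup>2"
proof -
  let ?L = "layer \<B> B0"
  have few_sources: "card {T\<in>?L i. exchange B0 T T'} \<le> (Suc i)\<^sup>2" if T': "T' \<in> ?L (Suc i)" for T'
  proof -
    have fin: "finite B0" "finite T'" using finite_lower_set B0 T' by (auto simp: layer_def)
    have "card {T\<in>?L i. exchange B0 T T'} \<le> card {T. exchange B0 T T'}"
      by (intro card_mono finite_exchange fin) auto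
    also have "\<dots> \<le> card (T' - B0) * card (B0 - T')" by (rule card_exchange_le[OF fin])
    also have "\<dots> = (Suc i)\<^sup>2"
      using card_Diff_layer[OF B0 T'] T' by (simp add: layer_def power2_eq_square)
    finally show ?thesis .
  qed
  have "card (?L i) * (d - i) = (\<Sum>T\<in>?L i. d - i)" by simp
  also have "\<dots> \<le> (\<Sum>T\<in>?L i. card {T'\<in>?L (Suc i). exchange B0 T T'})"
    by (intro sum_mono card_exchange_ge[OF B0 _ i_less] degree) (auto simp: layer_def)
  also have "\<dots> = (\<Sum>T'\<in>?L (Suc i). card {T\<in>?L i. exchange B0 T T'})"
    by (rule sum_multicount_gen) (simp_all add: finite_layer)
  also have "\<dots> \<le> (\<Sum>T'\<in>?L (Suc i). (Suc i)\<^sup>2)" by (intro sum_mono few_sources)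
  also have "\<dots> = card (?L (Suc i)) * (Suc i)\<^sup>2" by simp
  finally show ?thesis .
qed

lemma card_layer_ge:
  assumes B0: "B0 \<in> \<B>" and i_le: "i \<le> j" and degree: "\<And>T. T \<in> \<B> \<Longrightarrow> d \<le> card (sets_above \<A> T)"
  shows "(d - j) ^ i \<le> card (layer \<B> B0 i) * (fact i)\<^sup>2"
  using i_le
proof (induction i)
  case 0
  have "B0 \<in> layer \<B> B0 0" using B0 by (simp add: layer_def)
  then have "0 < card (layer \<B> B0 0)" using finite_layer by (auto simp: card_gt_0_iff)
  then show ?case by simp
next
  case (Suc i)
  let ?n = "\<lambda>i. card (layer \<B> B0 i)"
  have "(d - j) ^ Suc i \<le> (d - i) * (?n i * (fact i)\<^sup>2)"
    unfolding power_Suc using Suc by (intro mult_le_mono) auto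
  also have "\<dots> = (?n i * (d - i)) * (fact i)\<^sup>2" by (simp add: algebra_simps)
  also have "\<dots> \<le> (?n (Suc i) * (Suc i)\<^sup>2) * (fact i)\<^sup>2"
    using card_layer_Suc_ge[OF B0 _ degree, of i] Suc.prems by (intro mult_le_mono1) auto
  also have "\<dots> = ?n (Suc i) * (fact (Suc i))\<^sup>2"
    by (simp only: fact_Suc power_mult_distrib of_nat_id mult.assoc)
  finally show ?case .
qed

lemma card_layer_le:
  assumes B0: "B0 \<in> \<B>" and X: "finite X" "\<And>T. T \<in> \<B> \<Longrightarrow> X \<subseteq> T" "card X + j < r"
    and rare: "\<And>v. v \<notin> X \<Longrightarrow> card (sets_above \<B> {v}) \<le> R"
  shows "card (layer \<B> B0 j) \<le> (j + 1) * R"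
proof -
  let ?L = "layer \<B> B0 j"
  define s where "s = r - j - card X"
  have s_pos: "0 < s" using X(3) by (simp add: s_def)
  have fin: "finite B0" by (rule finite_lower_set[OF B0])
  have card_B0: "card (B0 - X) = s + j"
    using card_lower_set[OF B0] X(1,3) X(2)[OF B0] by (simp add: card_Diff_subset s_def)
  have common: "card {v\<in>B0 - X. v \<in> T} = s" if "T \<in> ?L" for T
  proof -
    have T: "X \<subseteq> T" "card (B0 - T) = j" using that X(2) by (auto simp: layer_def)
    have "{v\<in>B0 - X. v \<in> T} = (B0 - X) - (B0 - T)" by blast
    moreover have "B0 - T \<subseteq> B0 - X" using T(1) by blast
    ultimately show ?thesis using T(2) card_B0 fin by (simp add: card_Diff_subset)
  qed
  have "s * card ?L = (\<Sum>T\<in>?L. card {v\<in>B0 - X. v \<in> T})" using common by simp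
  also have "\<dots> = (\<Sum>v\<in>B0 - X. card {T\<in>?L. v \<in> T})"
    by (rule sum_multicount_gen) (use finite_layer fin in auto)
  also have "\<dots> \<le> (\<Sum>v\<in>B0 - X. R)"
  proof (rule sum_mono)
    fix v assume v: "v \<in> B0 - X"
    have "card {T\<in>?L. v \<in> T} \<le> card (sets_above \<B> {v})"
      using finite_lower by (intro card_mono) (auto simp: sets_above_def layer_def)
    also have "\<dots> \<le> R" using rare v by blast
    finally show "card {T\<in>?L. v \<in> T} \<le> R" .
  qed
  also have "\<dots> = (s + j) * R" using card_B0 by simp
  also have "\<dots> \<le> (s * (j + 1)) * R" using s_pos by (intro mult_le_mono1) (cases s, auto)
  finally show ?thesis using s_pos by (simp add: mult.assoc del: One_nat_def add_Suc_right)
qed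

lemma min_degree_pow_le:
  assumes "\<B> \<noteq> {}" "\<And>T. T \<in> \<B> \<Longrightarrow> d \<le> card (sets_above \<A> T)"
    and "finite X" "\<And>T. T \<in> \<B> \<Longrightarrow> X \<subseteq> T" "card X + j < r"
    and "\<And>v. v \<notin> X \<Longrightarrow> card (sets_above \<B> {v}) \<le> R"
  shows "(d - j) ^ j \<le> (fact j)\<^sup>2 * (j + 1) * R"
proof -
  obtain B0 where B0: "B0 \<in> \<B>" using assms(1) by blast
  have "(d - j) ^ j \<le> card (layer \<B> B0 j) * (fact j)\<^sup>2"
    by (rule card_layer_ge[OF B0 order_refl assms(2)])
  also have "\<dots> \<le> ((j + 1) * R) * (fact j)\<^sup>2"
    by (intro mult_le_mono1 card_layer_le[OF B0 assms(3-6)])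
  finally show ?thesis by (simp only: mult_ac)
qed

lemma card_upper_le_of_rare:
  assumes "0 < j" and X: "finite X" "card X + j < r" "card (sets_not_above \<B> X) < N"
    and rare: "\<And>v. v \<notin> X \<Longrightarrow> card (sets_above \<B> {v}) \<le> R"
    and degree: "(fact j)\<^sup>2 * (j + 1) * R < (Suc d - j) ^ j"
  shows "card \<A> \<le> d * card \<B> + (N * N + N)"
proof (rule ccontr)
  assume "\<not> ?thesis"
  then have "d * card \<B> < card (confined \<A> \<B> X)"
    using card_upper_le_confined[OF assms(1) X(3)] by linarith
  moreover have "d * card (sets_above \<B> X) \<le> d * card \<B>"
    using finite_lower by (intro mult_le_mono2 card_mono) (auto simp: sets_above_def)
  ultimately have "d * card (sets_above \<B> X) < card (confined \<A> \<B> X)" by linarith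
  then obtain \<A>' \<B>' where sub: "\<B>' \<subseteq> sets_above \<B> X" and nonempty: "\<B>' \<noteq> {}"
    and sys: "partial_shadow r j \<A>' \<B>'"
    and dense: "\<And>T. T \<in> \<B>' \<Longrightarrow> d < card (sets_above \<A>' T)"
    using obtain_min_degree_subsystem[OF partial_shadow_confined] by metis
  have "(Suc d - j) ^ j \<le> (fact j)\<^sup>2 * (j + 1) * R"
  proof (rule partial_shadow.min_degree_pow_le[OF sys nonempty _ X(1) _ X(2)])
    fix v assume "v \<notin> X"
    have "card (sets_above \<B>' {v}) \<le> card (sets_above \<B> {v})"
      using finite_lower sub by (intro card_mono) (auto simp: sets_above_def)
    then show "card (sets_above \<B>' {v}) \<le> R" using rare[OF \<open>v \<notin> X\<close>] by simp
  qed (use dense sub in \<open>auto simp: Suc_le_eq sets_above_def\<close>)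
  then show False using degree by simp
qed

end

section \<open>Splitting off all but boundedly many sets\<close>

lemma obtain_common_core:
  assumes fin: "finite \<B>" "\<And>T. T \<in> \<B> \<Longrightarrow> finite T" and large: "4 * N \<le> card \<B>"
    and minority: "\<And>X. card (sets_not_above \<B> X) \<le> card (sets_above \<B> X) \<Longrightarrow> card (sets_not_above \<B> X) < N"
    and rare: "\<And>v. card (sets_above \<B> {v}) < card (sets_not_above \<B> {v}) \<Longrightarrow> card (sets_above \<B> {v}) \<le> R"
  obtains X where "finite X" "\<And>Y. Y \<subseteq> X \<Longrightarrow> card (sets_not_above \<B> Y) < N"
    "\<And>v. v \<notin> X \<Longrightarrow> card (sets_above \<B> {v}) \<le> R"
proof
  define X where "X = {v. card (sets_not_above \<B> {v}) < N}"
  note card_split = card_sets_above_not_above[OF fin(1)]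
  have "0 < N" using minority[of "{}"] by (simp add: sets_not_above_def)
  have "X \<subseteq> \<Union>\<B>"
  proof
    fix v assume "v \<in> X"
    then have "0 < card (sets_above \<B> {v})" using card_split[of "{v}"] large \<open>0 < N\<close> by (simp add: X_def)
    then show "v \<in> \<Union>\<B>" by (force simp: sets_above_def card_gt_0_iff)
  qed
  then show fin_X: "finite X" using fin by (meson finite_Union finite_subset)
  show "card (sets_not_above \<B> Y) < N" if "Y \<subseteq> X" for Y
    using finite_subset[OF that fin_X] that
  proof (induction Y)
    case empty
    then show ?case using \<open>0 < N\<close> by (simp add: sets_not_above_def)
  next
    case (insert v Y)
    have "sets_not_above \<B> (insert v Y) = sets_not_above \<B> {v} \<union> sets_not_above \<B> Y"
      by (auto simp: sets_not_above_def)
    then have "card (sets_not_above \<B> (insert v Y)) \<le>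
        card (sets_not_above \<B> {v}) + card (sets_not_above \<B> Y)"
      by (simp add: card_Un_le)
    also have "\<dots> \<le> 2 * N" using insert by (simp add: X_def)
    finally show ?case using minority[of "insert v Y"] card_split[of "insert v Y"] large by linarith
  qed
  show "card (sets_above \<B> {v}) \<le> R" if "v \<notin> X" for v
    using that minority[of "{v}"] rare[of v] unfolding X_def mem_Collect_eq by (meson not_less)
qed

definition decomposable :: "nat \<Rightarrow> nat \<Rightarrow> nat \<Rightarrow> 'a set set \<Rightarrow> 'a set set \<Rightarrow> bool" where
  "decomposable j l N \<A> \<B> \<longleftrightarrow>
    (\<exists>X. card (sets_not_above \<B> X) < N \<and> card (confined \<A> \<B> X) \<le> kk j (card (sets_above \<B> X))) \<or>
    (\<exists>X. profitable_split j l (card (sets_above \<B> X)) (card (sets_not_above \<B> X)))"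

lemma (in partial_shadow) ex_confined_le_kk:
  assumes j: "0 < j" "j \<le> r"
    and core: "finite X" "\<And>Y. Y \<subseteq> X \<Longrightarrow> card (sets_not_above \<B> Y) < N"
      "\<And>v. v \<notin> X \<Longrightarrow> card (sets_above \<B> {v}) \<le> R"
    and level: "c choose j \<le> card \<B>"
    and degree: "d * card \<B> + (N * N + N) < c choose Suc j" "(fact j)\<^sup>2 * (j + 1) * R < (Suc d - j) ^ j"
  shows "\<exists>Y. card (sets_not_above \<B> Y) < N \<and> card (confined \<A> \<B> Y) \<le> kk j (card (sets_above \<B> Y))"
proof (cases "r - j \<le> card X")
  case True
  then obtain Y where Y: "Y \<subseteq> X" "card Y = r - j" by (meson obtain_subset_with_card_n)
  have "card (confined \<A> \<B> Y) \<le> kk j (card (sets_above \<B> Y))"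
    using j finite_subset[OF Y(1) core(1)] Y(2)
    by (intro partial_shadow.card_upper_le_kk[OF partial_shadow_confined]) (auto simp: sets_above_def)
  then show ?thesis using core(2)[OF Y(1)] by blast
next
  case False
  then have "card \<A> \<le> d * card \<B> + (N * N + N)"
    using card_upper_le_of_rare[OF j(1) core(1) _ core(2)[OF order_refl] core(3) degree(2)] by simp
  also have "\<dots> \<le> kk j (c choose j)" using degree(1) by (simp add: kk_choose[OF j(1)])
  also have "\<dots> \<le> kk j (card \<B>)" by (rule kk_mono[OF j(1) level])
  finally have "card (confined \<A> \<B> {}) \<le> kk j (card (sets_above \<B> {}))"
    by (simp add: confined_def sets_above_def sets_below_def)
  then show ?thesis using core(2)[of "{}"] by blast
qed

lemma (in partial_shadow) decomposableI:
  assumes j: "0 < j" "j \<le> r"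
    and profitable_ge: "\<And>m n. N \<le> n \<Longrightarrow> n \<le> m \<Longrightarrow> profitable_split j l m n"
    and profitable_le: "\<And>m n c. N \<le> n \<Longrightarrow> m \<le> n \<Longrightarrow> n < Suc c choose j \<Longrightarrow>
      4 * (j + 1) * (c choose (j - 1)) < m \<Longrightarrow> profitable_split j l m n"
    and large: "4 * N \<le> card \<B>" and level: "c choose j \<le> card \<B>" "card \<B> < Suc c choose j"
    and degree: "d * card \<B> + (N * N + N) < c choose Suc j"
      "(fact j)\<^sup>2 * (j + 1) * (4 * (j + 1) * (c choose (j - 1))) < (Suc d - j) ^ j"
  shows "decomposable j l N \<A> \<B>"
  unfolding decomposable_def
proof (rule disjCI)
  assume unprofitable: "\<nexists>X. profitable_split j l (card (sets_above \<B> X)) (card (sets_not_above \<B> X))"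
  let ?R = "4 * (j + 1) * (c choose (j - 1))"
  have minority: "card (sets_not_above \<B> X) < N"
    if "card (sets_not_above \<B> X) \<le> card (sets_above \<B> X)" for X
    using profitable_ge that unprofitable by (meson not_less)
  have rare: "card (sets_above \<B> {v}) \<le> ?R"
    if "card (sets_above \<B> {v}) < card (sets_not_above \<B> {v})" for v
  proof -
    have "N \<le> card (sets_not_above \<B> {v})" "card (sets_not_above \<B> {v}) < Suc c choose j"
      using that card_sets_above_not_above[OF finite_lower, of "{v}"] large level(2) by linarith+
    then show ?thesis using profitable_le that unprofitable by (meson less_imp_le not_less)
  qed
  obtain X where X: "finite X" "\<And>Y. Y \<subseteq> X \<Longrightarrow> card (sets_not_above \<B> Y) < N"
    "\<And>v. v \<notin> X \<Longrightarrow> card (sets_above \<B> {v}) \<le> ?R"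
    using obtain_common_core[OF finite_lower finite_lower_set large minority rare] by blast
  show "\<exists>Y. card (sets_not_above \<B> Y) < N \<and> card (confined \<A> \<B> Y) \<le> kk j (card (sets_above \<B> Y))"
    by (rule ex_confined_le_kk[OF j X level(1) degree])
qed

lemma large_partial_shadow_decomposable:
  assumes "0 < j"
  shows "\<exists>M N. \<forall>r \<A> (\<B> :: 'a set set). partial_shadow r j \<A> \<B> \<longrightarrow> j \<le> r \<longrightarrow> M \<le> card \<B> \<longrightarrow>
    decomposable j l N \<A> \<B>"
proof -
  obtain N where N: "\<forall>n\<ge>N. (\<forall>m\<ge>n. profitable_split j l m n) \<and>
      (\<forall>m\<le>n. \<forall>c. n < Suc c choose j \<longrightarrow>
        4 * (j + 1) * (c choose (j - 1)) < m \<longrightarrow> profitable_split j l m n)"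
    using eventually_conj[OF eventually_profitable_split_of_ge[OF assms, of l]
        eventually_profitable_split_of_le[OF assms, of l]]
    unfolding eventually_sequentially by blast
  define E where "E = (fact j)\<^sup>2 * (j + 1) * (4 * (j + 1))"
  obtain M where M: "\<forall>b\<ge>M. \<forall>c. b < Suc c choose j \<longrightarrow>
      (\<exists>d. (\<forall>b. b < Suc c choose j \<longrightarrow> d * b + (N * N + N) < c choose Suc j) \<and>
        E * (c choose (j - 1)) < (Suc d - j) ^ j)"
    using eventually_choose_level[OF eventually_min_degree_exists[OF assms, of "N * N + N" E], of j]
    unfolding eventually_sequentially by blast
  show ?thesis
  proof (rule exI[of _ "M + 4 * N"], rule exI[of _ N], intro allI impI)
    fix r \<A> and \<B> :: "'a set set"
    assume sys: "partial_shadow r j \<A> \<B>" and r: "j \<le> r" and large: "M + 4 * N \<le> card \<B>"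
    obtain c where level: "c choose j \<le> card \<B>" "card \<B> < Suc c choose j"
      by (rule obtain_choose_level[OF assms])
    then obtain d where "d * card \<B> + (N * N + N) < c choose Suc j"
        "E * (c choose (j - 1)) < (Suc d - j) ^ j"
      using M large by (meson add_leD1)
    then show "decomposable j l N \<A> \<B>"
      using N large
      by (intro partial_shadow.decomposableI[OF sys assms r _ _ _ level])
        (simp_all add: E_def mult.assoc)
  qed
qed

section \<open>Induction on the number of sets\<close>

lemma partial_shadow_error_induct:
  fixes \<A> \<B> :: "'a set set"
  assumes "partial_shadow r j \<A> \<B>" and j_pos: "0 < j"
    and decomposable: "\<And>\<A> (\<B> :: 'a set set). partial_shadow r j \<A> \<B> \<Longrightarrow> M \<le> card \<B> \<Longrightarrow>
      decomposable j l N \<A> \<B>"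
    and small: "\<And>\<A> (\<B> :: 'a set set). partial_shadow r j \<A> \<B> \<Longrightarrow> card \<B> < M \<Longrightarrow>
      card \<A> \<le> kk j (card \<B>) + err (card \<B>)"
    and err_ge: "\<And>n. M \<le> n \<Longrightarrow> N * N + N \<le> err n"
    and err_add: "\<And>m n. err m + err n \<le> err (m + n) + l * min m n"
  shows "card \<A> \<le> kk j (card \<B>) + err (card \<B>)"
  using assms(1)
proof (induction "card \<B>" arbitrary: \<A> \<B> rule: less_induct)
  case less
  interpret partial_shadow r j \<A> \<B> by (rule less.prems)
  note card_split = card_sets_above_not_above[OF finite_lower]
  consider (few) "card \<B> < M"
    | (few_outside) X where "M \<le> card \<B>" "card (sets_not_above \<B> X) < N"
        "card (confined \<A> \<B> X) \<le> kk j (card (sets_above \<B> X))"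
    | (split) X where "profitable_split j l (card (sets_above \<B> X)) (card (sets_not_above \<B> X))"
    using decomposable[OF less.prems] unfolding decomposable_def by force
  then show ?case
  proof cases
    case few
    then show ?thesis by (rule small[OF less.prems])
  next
    case (few_outside X)
    have "kk j (card (sets_above \<B> X)) \<le> kk j (card \<B>)"
      using card_split[of X] by (intro kk_mono j_pos) simp
    then show ?thesis
      using card_upper_le_confined[OF j_pos few_outside(2)] err_ge[OF few_outside(1)] few_outside(3)
      by linarith
  next
    case (split X)
    let ?m = "card (sets_above \<B> X)" and ?n = "card (sets_not_above \<B> X)"
    have "card (confined \<A> \<B> X) \<le> kk j ?m + err ?m" "card (sets_not_above \<A> X) \<le> kk j ?n + err ?n"
      using split card_split[of X]
      by (intro less.hyps partial_shadow_confined partial_shadow_sets_not_above;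
          simp add: profitable_split_def)+
    then show ?thesis
      using card_upper_split_le[of X] split card_split[of X] err_add[of ?m ?n]
      unfolding profitable_split_def by simp
  qed
qed

lemma partial_shadow_linear_error:
  assumes "0 < j"
  shows "\<exists>K. \<forall>r \<A> (\<B> :: 'a set set). j \<le> r \<longrightarrow> partial_shadow r j \<A> \<B> \<longrightarrow>
    card \<A> \<le> kk j (card \<B>) + K * card \<B>"
proof -
  obtain M N where decomposable: "\<And>r \<A> (\<B> :: 'a set set).
      partial_shadow r j \<A> \<B> \<Longrightarrow> j \<le> r \<Longrightarrow> M \<le> card \<B> \<Longrightarrow> decomposable j 0 N \<A> \<B>"
    using large_partial_shadow_decomposable[OF assms, of 0] by metis
  define K where "K = Suc M + (N * N + N)"
  have "card \<A> \<le> kk j (card \<B>) + K * card \<B>"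
    if r: "j \<le> r" and sys: "partial_shadow r j \<A> \<B>" for r \<A> and \<B> :: "'a set set"
  proof (rule partial_shadow_error_induct[OF sys assms, where M = "Suc M" and N = N and l = 0])
    fix \<A> and \<B> :: "'a set set"
    assume small: "partial_shadow r j \<A> \<B>" "card \<B> < Suc M"
    have "card \<A> \<le> card \<B> * card \<B>" by (rule partial_shadow.card_upper_le_square[OF small(1) assms])
    also have "\<dots> \<le> K * card \<B>" using small(2) by (intro mult_le_mono1) (simp add: K_def)
    finally show "card \<A> \<le> kk j (card \<B>) + K * card \<B>" by simp
  next
    fix n assume "Suc M \<le> n"
    then have "K * 1 \<le> K * n" by (intro mult_le_mono2) simp
    then show "N * N + N \<le> K * n" by (simp add: K_def)
  qed (use decomposable r in \<open>simp_all add: distrib_left\<close>)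
  then show ?thesis by blast
qed

lemma partial_shadow_bounded_error:
  assumes "0 < j"
  shows "\<exists>t. \<forall>r \<A> (\<B> :: 'a set set). j \<le> r \<longrightarrow> partial_shadow r j \<A> \<B> \<longrightarrow>
    card \<A> \<le> kk j (card \<B>) + t"
proof -
  obtain K where linear: "\<And>r \<A> (\<B> :: 'a set set). j \<le> r \<Longrightarrow> partial_shadow r j \<A> \<B> \<Longrightarrow>
    card \<A> \<le> kk j (card \<B>) + K * card \<B>" using partial_shadow_linear_error[OF assms] by metis
  obtain M N where decomposable: "\<And>r \<A> (\<B> :: 'a set set).
      partial_shadow r j \<A> \<B> \<Longrightarrow> j \<le> r \<Longrightarrow> M \<le> card \<B> \<Longrightarrow> decomposable j (Suc K) N \<A> \<B>"
    using large_partial_shadow_decomposable[OF assms, of "Suc K"] by metis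
  define M' where "M' = M + (N * N + N)"
  define err where "err n = min (M' * M') (Suc K * n)" for n
  have "card \<A> \<le> kk j (card \<B>) + err (card \<B>)"
    if r: "j \<le> r" and sys: "partial_shadow r j \<A> \<B>" for r \<A> and \<B> :: "'a set set"
  proof (rule partial_shadow_error_induct[OF sys assms, where M = M' and N = N and l = "Suc K"])
    fix \<A> and \<B> :: "'a set set"
    assume small: "partial_shadow r j \<A> \<B>" "card \<B> < M'"
    have "card \<A> \<le> card \<B> * card \<B>" by (rule partial_shadow.card_upper_le_square[OF small(1) assms])
    also have "\<dots> \<le> M' * M'" using small(2) by (intro mult_le_mono) simp_all
    finally show "card \<A> \<le> kk j (card \<B>) + err (card \<B>)"
      using linear[OF r small(1)] by (simp add: err_def)
  next
    fix n assume "M' \<le> n"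
    have "N * N + N \<le> M'" by (simp add: M'_def)
    moreover have "M' \<le> M' * M'" by simp
    ultimately have "N * N + N \<le> M' * M'" "N * N + N \<le> n" using \<open>M' \<le> n\<close> by linarith+
    then show "N * N + N \<le> err n" by (simp add: err_def)
  next
    fix m n
    show "err m + err n \<le> err (m + n) + Suc K * min m n"
      by (simp add: err_def min_def algebra_simps)
  qed (use decomposable r in \<open>simp_all add: M'_def\<close>)
  then have "\<forall>r \<A> (\<B> :: 'a set set). j \<le> r \<longrightarrow> partial_shadow r j \<A> \<B> \<longrightarrow>
      card \<A> \<le> kk j (card \<B>) + M' * M'"
    unfolding err_def by (meson add_left_mono le_trans min.cobounded1)
  then show ?thesis by blast
qed

section \<open>The function \<open>f\<close>\<close>

lemma partial_shadowI_shadow: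
  assumes "finite \<A>" "\<A> \<subseteq> [UNIV]\<^bsup>Suc j\<^esup>" "finite \<B>" "\<B> \<subseteq> [UNIV]\<^bsup>j\<^esup>" "shadow \<A> \<subseteq> \<B>"
  shows "partial_shadow j j \<A> \<B>"
proof
  fix S assume S: "S \<in> \<A>"
  have "inj_on (\<lambda>x. S - {x}) S" by (auto simp: inj_on_def)
  moreover have "(\<lambda>x. S - {x}) ` S \<subseteq> sets_below \<B> S"
    using assms(5) S by (auto simp: sets_below_def shadow_def)
  ultimately have "card S \<le> card (sets_below \<B> S)"
    using assms(3) by (intro card_inj_on_le) (auto simp: sets_below_def)
  moreover have "card S = Suc j" using assms(2) S by (auto simp: nsets_def)
  ultimately show "j < card (sets_below \<B> S)" by simp
qed (use assms in simp_all)

lemma (in partial_shadow) partial_shadow_Un: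
  assumes "finite X" "\<And>S. S \<in> \<A> \<union> \<B> \<Longrightarrow> S \<inter> X = {}"
  shows "partial_shadow (r + card X) j ((\<lambda>S. S \<union> X) ` \<A>) ((\<lambda>T. T \<union> X) ` \<B>)"
proof
  show "(\<lambda>S. S \<union> X) ` \<A> \<subseteq> [UNIV]\<^bsup>Suc (r + card X)\<^esup>" "(\<lambda>T. T \<union> X) ` \<B> \<subseteq> [UNIV]\<^bsup>(r + card X)\<^esup>"
    using assms finite_upper_set card_upper_set finite_lower_set card_lower_set
    by (auto simp: nsets_def card_Un_disjoint)
  fix R assume "R \<in> (\<lambda>S. S \<union> X) ` \<A>"
  then obtain S where S: "S \<in> \<A>" "R = S \<union> X" by blast
  have "inj_on (\<lambda>T. T \<union> X) (sets_below \<B> S)"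
    by (rule inj_on_inverseI[where g = "\<lambda>T. T - X"]) (use assms(2) in \<open>auto simp: sets_below_def\<close>)
  then have "card (sets_below \<B> S) \<le> card (sets_below ((\<lambda>T. T \<union> X) ` \<B>) R)"
    by (rule card_inj_on_le) (use finite_lower in \<open>auto simp: sets_below_def S\<close>)
  then show "j < card (sets_below ((\<lambda>T. T \<union> X) ` \<B>) R)" using many_below[OF S(1)] by simp
qed (use finite_upper finite_lower in simp_all)

lemma subfamily_iff_card_sets_below:
  assumes "finite \<B>"
  shows "(\<exists>\<S>. \<S> \<subseteq> \<B> \<and> card \<S> = k \<and> (\<forall>X\<in>\<S>. X \<subseteq> A)) \<longleftrightarrow> k \<le> card (sets_below \<B> A)"
proof
  assume "\<exists>\<S>. \<S> \<subseteq> \<B> \<and> card \<S> = k \<and> (\<forall>X\<in>\<S>. X \<subseteq> A)"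
  then obtain \<S> where "\<S> \<subseteq> sets_below \<B> A" "card \<S> = k" by (auto simp: sets_below_def)
  then show "k \<le> card (sets_below \<B> A)"
    using assms card_mono[of "sets_below \<B> A" \<S>] by (simp add: sets_below_def)
next
  assume "k \<le> card (sets_below \<B> A)"
  then obtain \<S> where "\<S> \<subseteq> sets_below \<B> A" "card \<S> = k" by (meson obtain_subset_with_card_n)
  then show "\<exists>\<S>. \<S> \<subseteq> \<B> \<and> card \<S> = k \<and> (\<forall>X\<in>\<S>. X \<subseteq> A)" by (auto simp: sets_below_def)
qed

lemma f_max_eq_Sup:
  "f_max (Suc r) (Suc j) b =
    Sup {enat (card \<A>) |\<A> (\<B> :: nat set set). partial_shadow r j \<A> \<B> \<and> card \<B> = b}"
proof -
  have "(finite \<A> \<and> \<A> \<subseteq> nsets_nat (Suc r) \<and> \<B> \<subseteq> nsets_nat (Suc r - 1) \<and> finite \<B> \<and> card \<B> = b \<and>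
      (\<forall>A\<in>\<A>. \<exists>\<S>. \<S> \<subseteq> \<B> \<and> card \<S> = Suc j \<and> (\<forall>X\<in>\<S>. X \<subseteq> A))) \<longleftrightarrow>
      partial_shadow r j \<A> \<B> \<and> card \<B> = b" for \<A> \<B>
    by (cases "finite \<B>")
      (auto simp: partial_shadow_def subfamily_iff_card_sets_below Suc_le_eq nsets_nat_def nsets_def)
  then show ?thesis unfolding f_max_def by simp
qed

lemma f_max_cascade_ge:
  assumes "mono e" "j \<le> r"
  shows "enat (cascade 1 j e) \<le> f_max (Suc r) (Suc j) (cascade 0 j e)"
proof -
  let ?\<A> = "colex 1 j e" and ?\<B> = "colex 0 j e"
  define X where "X = {j + e j..<j + e j + (r - j)}"
  have disjoint: "S \<inter> X = {}" if "S \<in> ?\<A> \<union> ?\<B>" for S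
    using that colex_notin[OF assms(1)] by (force simp: X_def)
  interpret partial_shadow j j ?\<A> ?\<B>
    using colex_subset_nsets[OF assms(1), of 0 j] shadow_colex_subset[OF assms(1), of 0 j]
      nsets_mono[of _ UNIV]
    by (intro partial_shadowI_shadow finite_colex colex_1_subset_nsets assms(1)) fastforce+
  have inj: "inj_on (\<lambda>S. S \<union> X) (?\<A> \<union> ?\<B>)"
    by (rule inj_on_inverseI[where g = "\<lambda>S. S - X"]) (use disjoint in blast)
  have "partial_shadow (j + card X) j ((\<lambda>S. S \<union> X) ` ?\<A>) ((\<lambda>T. T \<union> X) ` ?\<B>)"
    by (rule partial_shadow_Un) (use disjoint in \<open>simp_all add: X_def\<close>)
  then have "partial_shadow r j ((\<lambda>S. S \<union> X) ` ?\<A>) ((\<lambda>T. T \<union> X) ` ?\<B>)"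
    using assms(2) by (simp add: X_def)
  moreover have "card ((\<lambda>S. S \<union> X) ` ?\<A>) = cascade 1 j e" "card ((\<lambda>T. T \<union> X) ` ?\<B>) = cascade 0 j e"
    using inj by (simp_all add: card_image inj_on_Un card_colex[OF assms(1)])
  ultimately show ?thesis
    unfolding f_max_eq_Sup by (intro Sup_upper) (metis (mono_tags, lifting) mem_Collect_eq)
qed

lemma f_max_cascade_le:
  "\<exists>t. \<forall>r e. j \<le> r \<longrightarrow> mono e \<longrightarrow>
    f_max (Suc r) (Suc j) (cascade 0 j e) \<le> enat (cascade 1 j e + t)"
proof (cases "j = 0")
  case True
  have "card \<A> = 0" if "partial_shadow r j \<A> \<B>" "card \<B> = cascade 0 j e"
    for r e and \<A> \<B> :: "nat set set"
  proof -
    interpret partial_shadow r j \<A> \<B> by (rule that(1))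
    have "\<B> = {}" using that(2) True finite_lower by (simp add: cascade_def)
    then have "\<A> = {}" using sets_below_nonempty by (auto simp: sets_below_def)
    then show ?thesis by simp
  qed
  then have "f_max (Suc r) (Suc j) (cascade 0 j e) \<le> 0" for r e
    unfolding f_max_eq_Sup by (intro Sup_least) (force simp: zero_enat_def)
  then show ?thesis by (metis zero_le order_trans)
next
  case False
  then obtain t where "\<And>r \<A> (\<B> :: nat set set). j \<le> r \<Longrightarrow> partial_shadow r j \<A> \<B> \<Longrightarrow>
      card \<A> \<le> kk j (card \<B>) + t"
    using partial_shadow_bounded_error[of j] by blast
  then have "f_max (Suc r) (Suc j) (cascade 0 j e) \<le> enat (cascade 1 j e + t)"
    if "j \<le> r" "mono e" for r e
    unfolding f_max_eq_Sup using that kk_cascade[OF that(2), of j] by (intro Sup_least) fastforce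
  then show ?thesis by blast
qed

lemma cascade_of_increasing:
  fixes c :: "nat \<Rightarrow> nat"
  assumes increasing: "\<forall>i. 1 \<le> i \<longrightarrow> i < j \<longrightarrow> c i < c (i + 1)"
  obtains e where "mono e" "\<And>s. cascade s j e = (\<Sum>i=1..j. c i choose (i + s))"
proof
  have le_c: "i \<le> c (Suc i)" if "i < j" for i
    using that
  proof (induction i)
    case (Suc i)
    then show ?case using increasing[rule_format, of "Suc i"] by simp
  qed simp
  define e where "e i = c (Suc (min i (j - 1))) - min i (j - 1)" for i
  have "e i \<le> e (Suc i)" for i
  proof (cases "Suc i < j")
    case True
    then have "c (Suc i) - i \<le> c (Suc (Suc i)) - Suc i"
      using increasing[rule_format, of "Suc i"] by simp
    then show ?thesis using True by (simp add: e_def min_def)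
  next
    case False
    then have "min (Suc i) (j - 1) = min i (j - 1)" by auto
    then show ?thesis by (simp add: e_def)
  qed
  then show "mono e" by (simp add: mono_iff_le_Suc)
  have add_e: "i + e i = c (Suc i)" if "i < j" for i
  proof -
    have "min i (j - 1) = i" using that by simp
    then show ?thesis using le_c[OF that] by (simp add: e_def)
  qed
  show "cascade s j e = (\<Sum>i=1..j. c i choose (i + s))" for s
  proof -
    have "cascade s j e = (\<Sum>i<j. c (Suc i) choose (Suc i + s))"
      unfolding cascade_def using add_e by (intro sum.cong) auto
    then show ?thesis by (simp add: sum.atLeast1_atMost_eq lessThan_atLeast0)
  qed
qed

theorem theorem3:
  fixes k :: nat
  assumes "1 \<le> k"
  shows "\<exists>\<tau>::nat. \<forall>r c. k \<le> r \<longrightarrow>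
           (\<forall>i. 1 \<le> i \<longrightarrow> i < k - 1 \<longrightarrow> c i < c (i + 1)) \<longrightarrow>
           enat (\<Sum>i=1..k-1. c i choose (i + 1))
             \<le> f_max r k (\<Sum>i=1..k-1. c i choose i) \<and>
           f_max r k (\<Sum>i=1..k-1. c i choose i)
             \<le> enat ((\<Sum>i=1..k-1. c i choose (i + 1)) + \<tau>)"
proof -
  obtain j where k: "k = Suc j" using assms by (cases k) auto
  obtain t where upper: "\<And>r e. j \<le> r \<Longrightarrow> mono e \<Longrightarrow>
      f_max (Suc r) (Suc j) (cascade 0 j e) \<le> enat (cascade 1 j e + t)"
    using f_max_cascade_le by blast
  show ?thesis
  proof (intro exI[of _ t] allI impI)
    fix r and c :: "nat \<Rightarrow> nat"
    assume "k \<le> r" and increasing: "\<forall>i. 1 \<le> i \<longrightarrow> i < k - 1 \<longrightarrow> c i < c (i + 1)"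
    then obtain q where r: "r = Suc q" "j \<le> q" by (cases r) (auto simp: k)
    obtain e where e: "mono e" "\<And>s. cascade s j e = (\<Sum>i=1..j. c i choose (i + s))"
      using cascade_of_increasing[of j c] increasing by (auto simp: k)
    show "enat (\<Sum>i=1..k-1. c i choose (i + 1)) \<le> f_max r k (\<Sum>i=1..k-1. c i choose i) \<and>
        f_max r k (\<Sum>i=1..k-1. c i choose i) \<le> enat ((\<Sum>i=1..k-1. c i choose (i + 1)) + t)"
      using f_max_cascade_ge[OF e(1) r(2)] upper[OF r(2) e(1)] by (simp add: e(2) k r(1))
  qed
qed

end
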